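(* Let the geometric assumption and the CutFEM stability assumption (both defined in the context) hold. There is a constant $C_{\mathrm{pr}}$, independent of $\ell$ and of the cut configuration (the position of $\Gamma$ relative to the meshes), such that $$\|\mathcal I_\ell v\|_{A_\ell}\le C_{\mathrm{pr}}\,\|v\|_{A_{\ell-1}}\qquad\text{for all } v\in V_{\ell-1}.$$
   Context: Meshes and spaces. $d\in\{2,3\}$, $p\ge1$; $\Omega\subset\mathbb R^d$ is a bounded domain with boundary $\Gamma$ and outward unit normal $n$. $\mathcal M_0,\dots,\mathcal M_L$ are nested Cartesian background grids covering $\Omega$: the cells of $\mathcal M_\ell$ are closed axis-parallel cubes of edge $h_\ell$, and $\mathcal M_\ell$ is the uniform dyadic refinement of $\mathcal M_{\ell-1}$, so $h_\ell=h_{\ell-1}/2$. Active cells: $\mathcal M_{\ell,\Omega}=\{K\in\mathcal M_\ell:K\cap\Omega\ne\emptyset\}$; $\Omega_\ell$ is their union. Cut cells are those meeting $\Gamma$. $\mathbb Q_p(K)$: polynomials of degree at most $p$ in each variable. $V_\ell$: continuous functions on $\Omega_\ell$ that are in $\mathbb Q_p(K)$ on each active cell $K$. $\mathbb F_G=\mathbb F_G^\ell$: faces shared by two active cells at least one of which is cut. Forms. $A_\ell=a_\ell+g_\ell$ with $a_\ell(u,v)=(\nabla u,\nabla v)_\Omega-(\partial_n u,v)_\Gamma-(u,\partial_n v)_\Gamma+\gamma_D h_\ell^{-1}(u,v)_\Gamma$ and $g_\ell(u,v)=\gamma\sum_{F\in\mathbb F_G}\sum_{k=1}^p\frac{h_\ell^{2k-1}}{(k!)^2}(\llbracket\partial_n^k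 u\rrbracket,\llbracket\partial_n^k v\rrbracket)_F$, $\gamma\in(0,1]$ (on $F$, $n$ is a fixed unit normal and $\llbracket\cdot\rrbracket$ the jump). $\gamma,\gamma_D$ are the same on all levels. $\|v\|_{A_\ell}^2:=A_\ell(v,v)$. The prolongation $\mathcal I_\ell:V_{\ell-1}\to V_\ell$ is the identity on functions: $\mathcal I_\ell v=v|_{\Omega_\ell}$, well defined because $\Omega_\ell\subseteq\Omega_{\ell-1}$. Geometric assumption. $\Gamma$ is $C^2$ with positive reach $\delta_0>0$ (the closest-point projection onto $\Gamma$ is well defined and $C^1$ in the tube of radius $\delta_0$). On every level, if $\Gamma$ meets a cell $K$, then $\Gamma\cap K$ is a single curve (surface) intersecting $\partial K$ exactly twice (in a single closed curve if $d=3$), each closed face is intersected at most once, and $K\setminus\Gamma$ has exactly two connected components. $\Gamma$ contains no mesh vertex of any $\mathcal M_\ell$, $\Omega_\ell\subseteq\Omega_{\ell-1}$ for all $\ell$, and $c_R h_{\ell-1}\le\delta_0$ on every level used, with $c_R=24d+10\sqrt d$. CutFEM stability assumption. With $N_\ell(v)^2:=\|\nabla v\|_{0,\Omega}^2+h_\ell\|\partial_n v\|_{0,\Gamma}^2+h_\ell^{-1}\|v\|_{0,\Gamma}^2+g_\ell(v,v)$, one has for $u,v\in V_\ell$, on every level: $c_A N_\ell(v)^2\le A_\ell(v,v)$, $A_\ell(u,v)\le C_A N_\ell(u)N_\ell(v)$, and $|v|_{1,\Omega_\ell\setminus\Omega}^2\le C(|v|_{1,\Omega}^2+g_\ell(v,v))$,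 where $c_A,C_A,C>0$ are independent of $\ell$ and of the cut configuration. *)

theory Defs
  imports "HOL-Analysis.Analysis"
begin

section \<open>Hausdorff and surface measure\<close>

text \<open>
  Covers by arbitrary sets of diameter at most \<open>\<delta>\<close>, weighted so that \<open>s\<close>-dimensional Hausdorff
  measure agrees with the usual \<open>s\<close>-dimensional area. The library's \<^const>\<open>outer_measure\<close> ranges over
  disjoint covers, which does not change the infimum because the weight is monotone.
  Only dimensions \<open>s \<ge> 1\<close> are meant.
\<close>

definition hausdorff_weight :: "nat \<Rightarrow> real \<Rightarrow> 'a::metric_space set \<Rightarrow> ennreal" where
  "hausdorff_weight s \<delta> C =
     (if bounded C \<and> diameter C \<le> \<delta>
      then ennreal (unit_ball_vol (real s) * (diameter C / 2) ^ s) else \<infinity>)"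

definition hausdorff_outer :: "nat \<Rightarrow> 'a::metric_space set \<Rightarrow> ennreal" where
  "hausdorff_outer s A = (SUP \<delta>\<in>{0<..}. outer_measure (Pow UNIV) (hausdorff_weight s \<delta>) A)"

definition hausdorff_measure :: "nat \<Rightarrow> 'a::metric_space measure" where
  "hausdorff_measure s =
     measure_of UNIV (lambda_system UNIV (Pow UNIV) (hausdorff_outer s)) (hausdorff_outer s)"

definition surface_measure :: "(real^'n) measure" where
  "surface_measure = hausdorff_measure (CARD('n) - 1)"

lemma positive_hausdorff_weight:
  assumes "0 < s" "0 < \<delta>"
  shows "positive (Pow UNIV) (hausdorff_weight s \<delta>)"
  using assms by (simp add: positive_def hausdorff_weight_def)

lemma increasing_hausdorff_weight: "increasing (Pow UNIV) (hausdorff_weight s \<delta>)"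
  unfolding increasing_def
proof (intro ballI impI)
  fix A B :: "'a set" assume "A \<subseteq> B"
  show "hausdorff_weight s \<delta> A \<le> hausdorff_weight s \<delta> B"
  proof (cases "bounded B \<and> diameter B \<le> \<delta>")
    case True
    then have "bounded A" "diameter A \<le> diameter B" "0 \<le> diameter A"
      using \<open>A \<subseteq> B\<close> by (auto intro: bounded_subset diameter_subset diameter_ge_0)
    then show ?thesis
      using True by (auto simp: hausdorff_weight_def intro!: ennreal_leI mult_left_mono power_mono)
  next
    case False
    then have "hausdorff_weight s \<delta> B = \<infinity>"
      by (auto simp: hausdorff_weight_def)
    then show ?thesis by simp
  qed
qed

lemma outer_measure_space_hausdorff:
  assumes "0 < s"
  shows "outer_measure_space (Pow UNIV) (hausdorff_outer s :: 'a::metric_space set \<Rightarrow> ennreal)"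
proof -
  interpret sigma_algebra UNIV "Pow UNIV :: 'a set set" by (rule sigma_algebra_Pow)
  have om: "outer_measure_space (Pow UNIV)
      (outer_measure (Pow UNIV) (hausdorff_weight s \<delta> :: 'a set \<Rightarrow> ennreal))"
    if "0 < \<delta>" for \<delta>
    using assms that
    by (intro outer_measure_space_outer_measure positive_hausdorff_weight increasing_hausdorff_weight)
  have "hausdorff_outer s ({} :: 'a set) = 0"
    unfolding hausdorff_outer_def
    using om by (intro SUP_eq_const) (auto simp: outer_measure_space_def positive_def
      intro!: exI[of _ "1::real"])
  moreover have "hausdorff_outer s A \<le> hausdorff_outer s B" if "A \<subseteq> B" for A B :: "'a set"
    using om that unfolding hausdorff_outer_def outer_measure_space_def increasing_def
    by (intro SUP_mono) auto
  moreover have "hausdorff_outer s (\<Union>i. A i) \<le> (\<Sum>i. hausdorff_outer s (A i))"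
    if dis: "disjoint_family A" for A :: "nat \<Rightarrow> 'a set"
    unfolding hausdorff_outer_def[of s "\<Union>i. A i"]
  proof (rule SUP_least)
    fix \<delta> :: real assume \<delta>: "\<delta> \<in> {0<..}"
    have "outer_measure (Pow UNIV) (hausdorff_weight s \<delta>) (\<Union>i. A i)
        \<le> (\<Sum>i. outer_measure (Pow UNIV) (hausdorff_weight s \<delta>) (A i))"
      using om[of \<delta>] \<delta> dis by (auto simp: outer_measure_space_def countably_subadditive_def)
    also have "\<dots> \<le> (\<Sum>i. hausdorff_outer s (A i))"
      using \<delta> by (intro suminf_le) (auto simp: hausdorff_outer_def intro: SUP_upper)
    finally show "outer_measure (Pow UNIV) (hausdorff_weight s \<delta>) (\<Union>i. A i)
        \<le> (\<Sum>i. hausdorff_outer s (A i))" .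
  qed
  ultimately show ?thesis
    by (simp add: outer_measure_space_def positive_def increasing_def countably_subadditive_def)
qed

lemma
  fixes A :: "'a::metric_space set"
  assumes "0 < s"
  shows sets_hausdorff_measure:
      "sets (hausdorff_measure s :: 'a measure) = lambda_system UNIV (Pow UNIV) (hausdorff_outer s)"
    and emeasure_hausdorff_measure:
      "A \<in> sets (hausdorff_measure s) \<Longrightarrow> emeasure (hausdorff_measure s) A = hausdorff_outer s A"
proof -
  interpret sigma_algebra UNIV "Pow UNIV :: 'a set set" by (rule sigma_algebra_Pow)
  let ?H = "hausdorff_outer s :: 'a set \<Rightarrow> ennreal"
  have ms: "measure_space UNIV (lambda_system UNIV (Pow UNIV) ?H) ?H"
    by (rule caratheodory_lemma[OF outer_measure_space_hausdorff[OF assms]])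
  then interpret L: sigma_algebra UNIV "lambda_system UNIV (Pow UNIV) ?H"
    unfolding measure_space_def by blast
  show sets: "sets (hausdorff_measure s :: 'a measure) = lambda_system UNIV (Pow UNIV) (hausdorff_outer s)"
    unfolding hausdorff_measure_def by (rule L.sets_measure_of_eq)
  show "emeasure (hausdorff_measure s) A = hausdorff_outer s A"
    if "A \<in> sets (hausdorff_measure s)"
    using ms that emeasure_measure_of_sigma[OF L.sigma_algebra_axioms]
    by (simp add: measure_space_def sets) (simp add: hausdorff_measure_def)
qed


section \<open>Smooth boundaries\<close>

definition C1_on ::
  "'a::real_normed_vector set \<Rightarrow> ('a \<Rightarrow> 'b::real_normed_vector) \<Rightarrow> bool" where
  "C1_on U f \<longleftrightarrow> (\<exists>f'. (\<forall>x\<in>U. (f has_derivative blinfun_apply (f' x)) (at x)) \<and> continuous_on U f')"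

definition C2_on ::
  "'a::real_normed_vector set \<Rightarrow> ('a \<Rightarrow> 'b::real_normed_vector) \<Rightarrow> bool" where
  "C2_on U f \<longleftrightarrow> (\<exists>f'. (\<forall>x\<in>U. (f has_derivative blinfun_apply (f' x)) (at x)) \<and> C1_on U f')"

definition gradient :: "(real^'n) set \<Rightarrow> (real^'n \<Rightarrow> real) \<Rightarrow> real^'n \<Rightarrow> real^'n" where
  "gradient S f x = (\<chi> i. frechet_derivative f (at x within S) (axis i 1))"

definition defining_function ::
  "(real^'n) set \<Rightarrow> real^'n \<Rightarrow> (real^'n) set \<Rightarrow> (real^'n \<Rightarrow> real) \<Rightarrow> bool" where
  "defining_function \<Omega> x U \<phi> \<longleftrightarrow>
     open U \<and> x \<in> U \<and> C2_on U \<phi> \<and> (\<forall>y\<in>U. gradient UNIV \<phi> y \<noteq> 0) \<and>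
     \<Omega> \<inter> U = {y\<in>U. \<phi> y < 0} \<and> frontier \<Omega> \<inter> U = {y\<in>U. \<phi> y = 0}"

definition C2_boundary :: "(real^'n) set \<Rightarrow> bool" where
  "C2_boundary \<Omega> \<longleftrightarrow> (\<forall>x\<in>frontier \<Omega>. \<exists>U \<phi>. defining_function \<Omega> x U \<phi>)"

definition outward_normal :: "(real^'n) set \<Rightarrow> real^'n \<Rightarrow> real^'n" where
  "outward_normal \<Omega> x =
     (THE \<nu>. \<exists>U \<phi>. defining_function \<Omega> x U \<phi> \<and> \<nu> = sgn (gradient UNIV \<phi> x))"

definition C1_closest_point_projection :: "(real^'n) set \<Rightarrow> real \<Rightarrow> bool" where
  "C1_closest_point_projection \<Gamma> \<delta> \<longleftrightarrow>
     (\<exists>\<pi>. (\<forall>x. infdist x \<Gamma> < \<delta> \<longrightarrow>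
              \<pi> x \<in> \<Gamma> \<and> (\<forall>y\<in>\<Gamma>. dist x y = infdist x \<Gamma> \<longleftrightarrow> y = \<pi> x)) \<and>
          C1_on {x. infdist x \<Gamma> < \<delta>} \<pi>)"


section \<open>Background grids\<close>

definition cube :: "real^'n \<Rightarrow> real \<Rightarrow> (real^'n) set" where
  "cube a h = cbox a (\<chi> i. a $ i + h)"

definition cube_vertices :: "real^'n \<Rightarrow> real \<Rightarrow> (real^'n) set" where
  "cube_vertices a h = {x. \<forall>i. x $ i = a $ i \<or> x $ i = a $ i + h}"

definition cube_faces :: "real^'n \<Rightarrow> real \<Rightarrow> (real^'n) set set" where
  "cube_faces a h = {{x \<in> cube a h. x $ i = c} | i c. c = a $ i \<or> c = a $ i + h}"

text \<open>A grid may be any collection of cells of one uniform lattice, e.g. those of a bounding box.\<close>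

definition cartesian_grid :: "real \<Rightarrow> (real^'n) set set \<Rightarrow> bool" where
  "cartesian_grid h \<M> \<longleftrightarrow>
     0 < h \<and> (\<exists>b. \<M> \<subseteq> {cube (b + h *\<^sub>R z) h | z. \<forall>i. z $ i \<in> \<int>})"

definition dyadic_refinement :: "real \<Rightarrow> (real^'n) set set \<Rightarrow> (real^'n) set set" where
  "dyadic_refinement h \<M> =
     {cube (a + (h / 2) *\<^sub>R e) (h / 2) | a e. cube a h \<in> \<M> \<and> (\<forall>i. e $ i \<in> {0, 1})}"

definition grid_hierarchy ::
  "(real^'n) set \<Rightarrow> nat \<Rightarrow> (nat \<Rightarrow> real) \<Rightarrow> (nat \<Rightarrow> (real^'n) set set) \<Rightarrow> bool" where
  "grid_hierarchy \<Omega> L h \<M> \<longleftrightarrow>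
     (\<forall>l\<le>L. cartesian_grid (h l) (\<M> l) \<and> \<Omega> \<subseteq> \<Union>(\<M> l)) \<and>
     (\<forall>l. 1 \<le> l \<and> l \<le> L \<longrightarrow>
        h l = h (l - 1) / 2 \<and> \<M> l = dyadic_refinement (h (l - 1)) (\<M> (l - 1)))"

definition active_cells :: "(real^'n) set \<Rightarrow> (real^'n) set set \<Rightarrow> (real^'n) set set" where
  "active_cells \<Omega> \<M> = {K \<in> \<M>. K \<inter> \<Omega> \<noteq> {}}"

definition active_domain :: "(real^'n) set \<Rightarrow> (real^'n) set set \<Rightarrow> (real^'n) set" where
  "active_domain \<Omega> \<M> = \<Union>(active_cells \<Omega> \<M>)"

definition is_cut :: "(real^'n) set \<Rightarrow> (real^'n) set \<Rightarrow> bool" where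
  "is_cut \<Omega> K \<longleftrightarrow> K \<inter> frontier \<Omega> \<noteq> {}"

text \<open>
  A pair \<open>(a, i)\<close> stands for the face shared by \<open>cube a h\<close> and its upper neighbour in direction \<open>i\<close>;
  each interior face is listed once, with fixed unit normal \<open>axis i 1\<close>.
\<close>

definition ghost_faces ::
  "(real^'n) set \<Rightarrow> (real^'n) set set \<Rightarrow> real \<Rightarrow> ((real^'n) \<times> 'n) set" where
  "ghost_faces \<Omega> \<M> h =
     {(a, i). cube a h \<in> active_cells \<Omega> \<M> \<and> cube (a + axis i h) h \<in> active_cells \<Omega> \<M> \<and>
        (is_cut \<Omega> (cube a h) \<or> is_cut \<Omega> (cube (a + axis i h) h))}"


section \<open>Finite element spaces\<close>

definition Qpoly :: "nat \<Rightarrow> (real^'n \<Rightarrow> real) set" where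
  "Qpoly p = {q. \<exists>c :: ('n \<Rightarrow> nat) \<Rightarrow> real.
     q = (\<lambda>x. \<Sum>\<alpha> | \<forall>i. \<alpha> i \<le> p. c \<alpha> * (\<Prod>i\<in>UNIV. (x $ i) ^ \<alpha> i))}"

text \<open>
  Functions on \<open>\<Omega>\<^sub>l\<close> are total functions that are \<^const>\<open>undefined\<close> outside; all derivatives below only
  use values in \<open>\<Omega>\<^sub>l\<close>.
\<close>

definition fe_space :: "nat \<Rightarrow> (real^'n) set \<Rightarrow> (real^'n) set set \<Rightarrow> (real^'n \<Rightarrow> real) set" where
  "fe_space p \<Omega> \<M> =
     {v \<in> extensional (active_domain \<Omega> \<M>). continuous_on (active_domain \<Omega> \<M>) v \<and>
        (\<forall>K\<in>active_cells \<Omega> \<M>. \<exists>q\<in>Qpoly p. \<forall>x\<in>K. v x = q x)}"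

definition prolongation ::
  "(real^'n) set \<Rightarrow> (real^'n) set set \<Rightarrow> (real^'n \<Rightarrow> real) \<Rightarrow> real^'n \<Rightarrow> real" where
  "prolongation \<Omega> \<M> v = restrict v (active_domain \<Omega> \<M>)"

definition cell_poly :: "nat \<Rightarrow> (real^'n) set \<Rightarrow> (real^'n \<Rightarrow> real) \<Rightarrow> real^'n \<Rightarrow> real" where
  "cell_poly p K v = (THE q. q \<in> Qpoly p \<and> (\<forall>x\<in>K. v x = q x))"

text \<open>The one-sided derivative from the cell \<open>K\<close>, through the polynomial that \<open>v\<close> agrees with on \<open>K\<close>.\<close>

definition cell_normal_deriv ::
  "nat \<Rightarrow> nat \<Rightarrow> 'n \<Rightarrow> (real^'n) set \<Rightarrow> (real^'n \<Rightarrow> real) \<Rightarrow> real^'n \<Rightarrow> real" where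
  "cell_normal_deriv p k i K v x = (deriv ^^ k) (\<lambda>t. cell_poly p K v (x + axis i t)) 0"

definition jump_normal_deriv ::
  "nat \<Rightarrow> real \<Rightarrow> (real^'n) \<times> 'n \<Rightarrow> nat \<Rightarrow> (real^'n \<Rightarrow> real) \<Rightarrow> real^'n \<Rightarrow> real" where
  "jump_normal_deriv p h = (\<lambda>(a, i) k v x.
     cell_normal_deriv p k i (cube a h) v x - cell_normal_deriv p k i (cube (a + axis i h) h) v x)"

definition face_set :: "real \<Rightarrow> (real^'n) \<times> 'n \<Rightarrow> (real^'n) set" where
  "face_set h = (\<lambda>(a, i). cube a h \<inter> cube (a + axis i h) h)"


section \<open>Forms and norms\<close>

definition nabla ::
  "(real^'n) set \<Rightarrow> (real^'n) set set \<Rightarrow> (real^'n \<Rightarrow> real) \<Rightarrow> real^'n \<Rightarrow> real^'n" where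
  "nabla \<Omega> \<M> v = gradient (active_domain \<Omega> \<M>) v"

definition normal_deriv ::
  "(real^'n) set \<Rightarrow> (real^'n) set set \<Rightarrow> (real^'n \<Rightarrow> real) \<Rightarrow> real^'n \<Rightarrow> real" where
  "normal_deriv \<Omega> \<M> v x = nabla \<Omega> \<M> v x \<bullet> outward_normal \<Omega> x"

definition surface_inner ::
  "(real^'n) set \<Rightarrow> (real^'n \<Rightarrow> real) \<Rightarrow> (real^'n \<Rightarrow> real) \<Rightarrow> real" where
  "surface_inner S u v = (LINT x:S|surface_measure. u x * v x)"

definition a_form ::
  "real \<Rightarrow> (real^'n) set \<Rightarrow> (real^'n) set set \<Rightarrow> real \<Rightarrow>
   (real^'n \<Rightarrow> real) \<Rightarrow> (real^'n \<Rightarrow> real) \<Rightarrow> real" where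
  "a_form \<gamma>D \<Omega> \<M> h u v =
     (LINT x:\<Omega>|lebesgue. nabla \<Omega> \<M> u x \<bullet> nabla \<Omega> \<M> v x)
     - surface_inner (frontier \<Omega>) (normal_deriv \<Omega> \<M> u) v
     - surface_inner (frontier \<Omega>) u (normal_deriv \<Omega> \<M> v)
     + \<gamma>D / h * surface_inner (frontier \<Omega>) u v"

definition g_form ::
  "nat \<Rightarrow> real \<Rightarrow> (real^'n) set \<Rightarrow> (real^'n) set set \<Rightarrow> real \<Rightarrow>
   (real^'n \<Rightarrow> real) \<Rightarrow> (real^'n \<Rightarrow> real) \<Rightarrow> real" where
  "g_form p \<gamma> \<Omega> \<M> h u v =
     \<gamma> * (\<Sum>F\<in>ghost_faces \<Omega> \<M> h. \<Sum>k=1..p. h ^ (2 * k - 1) / (fact k)\<^sup>2 *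
            surface_inner (face_set h F) (jump_normal_deriv p h F k u) (jump_normal_deriv p h F k v))"

definition A_form ::
  "nat \<Rightarrow> real \<Rightarrow> real \<Rightarrow> (real^'n) set \<Rightarrow> (real^'n) set set \<Rightarrow> real \<Rightarrow>
   (real^'n \<Rightarrow> real) \<Rightarrow> (real^'n \<Rightarrow> real) \<Rightarrow> real" where
  "A_form p \<gamma> \<gamma>D \<Omega> \<M> h u v = a_form \<gamma>D \<Omega> \<M> h u v + g_form p \<gamma> \<Omega> \<M> h u v"

definition energy_norm ::
  "nat \<Rightarrow> real \<Rightarrow> real \<Rightarrow> (real^'n) set \<Rightarrow> (real^'n) set set \<Rightarrow> real \<Rightarrow> (real^'n \<Rightarrow> real) \<Rightarrow> real" where
  "energy_norm p \<gamma> \<gamma>D \<Omega> \<M> h v = sqrt (A_form p \<gamma> \<gamma>D \<Omega> \<M> h v v)"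

definition H1_seminorm_sq ::
  "(real^'n) set \<Rightarrow> (real^'n) set set \<Rightarrow> (real^'n) set \<Rightarrow> (real^'n \<Rightarrow> real) \<Rightarrow> real" where
  "H1_seminorm_sq \<Omega> \<M> S v = (LINT x:S|lebesgue. (norm (nabla \<Omega> \<M> v x))\<^sup>2)"

definition N_norm ::
  "nat \<Rightarrow> real \<Rightarrow> (real^'n) set \<Rightarrow> (real^'n) set set \<Rightarrow> real \<Rightarrow> (real^'n \<Rightarrow> real) \<Rightarrow> real" where
  "N_norm p \<gamma> \<Omega> \<M> h v = sqrt (
     H1_seminorm_sq \<Omega> \<M> \<Omega> v
     + h * surface_inner (frontier \<Omega>) (normal_deriv \<Omega> \<M> v) (normal_deriv \<Omega> \<M> v)
     + 1 / h * surface_inner (frontier \<Omega>) v v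
     + g_form p \<gamma> \<Omega> \<M> h v v)"


section \<open>Standing assumptions\<close>

text \<open>
  For \<open>d = 3\<close>, \<open>\<Gamma>\<close> is already a hypersurface, so "a single surface" and "intersected at most once"
  say that the intersection is connected (possibly empty for a face).
\<close>

definition resolved_cut :: "(real^'n) set \<Rightarrow> real^'n \<Rightarrow> real \<Rightarrow> bool" where
  "resolved_cut \<Gamma> a h \<longleftrightarrow>
     (CARD('n) = 2 \<longrightarrow>
        (\<exists>g. arc g \<and> path_image g = \<Gamma> \<inter> cube a h) \<and>
        card (\<Gamma> \<inter> frontier (cube a h)) = 2 \<and>
        (\<forall>F\<in>cube_faces a h. \<exists>x. \<Gamma> \<inter> F \<subseteq> {x})) \<and>
     (CARD('n) = 3 \<longrightarrow>
        connected (\<Gamma> \<inter> cube a h) \<and>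
        (\<exists>g. simple_path g \<and> pathfinish g = pathstart g \<and>
             path_image g = \<Gamma> \<inter> frontier (cube a h)) \<and>
        (\<forall>F\<in>cube_faces a h. connected (\<Gamma> \<inter> F))) \<and>
     card (components (cube a h - \<Gamma>)) = 2"

definition geometric_assumption ::
  "(real^'n) set \<Rightarrow> real \<Rightarrow> nat \<Rightarrow> (nat \<Rightarrow> real) \<Rightarrow> (nat \<Rightarrow> (real^'n) set set) \<Rightarrow> bool" where
  "geometric_assumption \<Omega> \<delta>0 L h \<M> \<longleftrightarrow>
     C2_boundary \<Omega> \<and> 0 < \<delta>0 \<and> C1_closest_point_projection (frontier \<Omega>) \<delta>0 \<and>
     (\<forall>l\<le>L. \<forall>a. cube a (h l) \<in> \<M> l \<longrightarrow>
        (is_cut \<Omega> (cube a (h l)) \<longrightarrow> resolved_cut (frontier \<Omega>) a (h l)) \<and>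
        frontier \<Omega> \<inter> cube_vertices a (h l) = {}) \<and>
     (\<forall>l. 1 \<le> l \<and> l \<le> L \<longrightarrow>
        active_domain \<Omega> (\<M> l) \<subseteq> active_domain \<Omega> (\<M> (l - 1)) \<and>
        (24 * real CARD('n) + 10 * sqrt (real CARD('n))) * h (l - 1) \<le> \<delta>0)"

definition cutfem_stability ::
  "nat \<Rightarrow> real \<Rightarrow> real \<Rightarrow> real \<Rightarrow> real \<Rightarrow> real \<Rightarrow>
   (real^'n) set \<Rightarrow> nat \<Rightarrow> (nat \<Rightarrow> real) \<Rightarrow> (nat \<Rightarrow> (real^'n) set set) \<Rightarrow> bool" where
  "cutfem_stability p \<gamma> \<gamma>D cA CA C \<Omega> L h \<M> \<longleftrightarrow>
     (\<forall>l\<le>L. \<forall>u\<in>fe_space p \<Omega> (\<M> l). \<forall>v\<in>fe_space p \<Omega> (\<M> l).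
        cA * (N_norm p \<gamma> \<Omega> (\<M> l) (h l) v)\<^sup>2 \<le> A_form p \<gamma> \<gamma>D \<Omega> (\<M> l) (h l) v v \<and>
        A_form p \<gamma> \<gamma>D \<Omega> (\<M> l) (h l) u v
          \<le> CA * N_norm p \<gamma> \<Omega> (\<M> l) (h l) u * N_norm p \<gamma> \<Omega> (\<M> l) (h l) v \<and>
        H1_seminorm_sq \<Omega> (\<M> l) (active_domain \<Omega> (\<M> l) - \<Omega>) v
          \<le> C * (H1_seminorm_sq \<Omega> (\<M> l) \<Omega> v + g_form p \<gamma> \<Omega> (\<M> l) (h l) v v))"

end

theory Submission
  imports Defs "HOL-Computational_Algebra.Polynomial"
begin

text \<open>
  Let \<open>w\<close> be the restriction of a coarse function \<open>v\<close> to the finer active domain. The stability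
  assumption says that on each level the form \<open>A\<close> is equivalent to \<open>N\<^sup>2\<close>, the squared \<^const>\<open>N_norm\<close>,
  with constants that do not see the level or the cut. So it suffices to bound \<open>N(w)\<^sup>2\<close> on the fine
  level by a fixed multiple of \<open>N(v)\<^sup>2\<close> on the coarse one, and this is done term by term.

  The three terms that live on \<open>\<Omega>\<close> and \<open>\<Gamma>\<close> involve the same integrands on both levels, so that only the
  powers of the mesh size change, by a factor of at most 2. In \<open>\<Omega>\<close> this is clear, since \<open>\<Omega>\<close> is an open
  subset of both active domains. On \<open>\<Gamma>\<close> it needs an argument, because gradients there are taken
  within the active domain: a priori \<open>\<Gamma>\<close> could run along the boundary of the active domain, and \<open>v\<close> could
  fail to be differentiable on a part of \<open>\<Gamma>\<close> of positive area. But a grid cell that \<open>\<Gamma>\<close> touches is cut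
  into two pieces, hence meets \<open>\<Omega>\<close> (\<open>resolved_cut_cell_active\<close>). So near a point of \<open>\<Gamma>\<close> both active
  domains are simply the region covered by the grid, and the two gradients are the same object
  (\<open>nabla_prolong\<close>).

  For the ghost penalty, let \<open>F\<close> be a face shared by two active fine cells one of which is cut. If both
  cells have the same coarse parent, \<open>w\<close> is one polynomial across \<open>F\<close> and every jump vanishes.
  Otherwise the two parents are neighbours, both are active, one of them is cut, and \<open>F\<close> lies in their common
  face, which is therefore a coarse ghost face on which \<open>v\<close> has the same jumps
  (\<open>fine_ghost_face_cases\<close>). A coarse face receives boundedly many fine faces, and the weights
  \<open>h\<^sup>2\<^sup>k\<^sup>-\<^sup>1\<close> decrease under refinement.

  The last step compares the integral of a squared jump over a small face with the one over a larger face.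
  A Lebesgue integral is 0 when its integrand is not integrable, so that this monotonicity requires the
  squared jump, a polynomial, to be integrable over a face for the Hausdorff measure. That rests on two
  facts: Borel sets are Hausdorff measurable, by Caratheodory's criterion for metric outer measures,
  and a face has finite Hausdorff measure.
\<close>

section \<open>Hausdorff measures are Borel measures\<close>

lemma outer_measure_space_subadd:
  assumes om: "outer_measure_space (Pow UNIV) f"
  shows "f (A \<union> B) \<le> f A + f B"
proof -
  interpret sigma_algebra UNIV "Pow UNIV :: 'a set set" by (rule sigma_algebra_Pow)
  have "f (A \<union> (B - A)) \<le> f A + f (B - A)"
    using om by (intro subadditiveD[OF countably_subadditive_subadditive])
      (auto simp: outer_measure_space_def)
  also have "f (B - A) \<le> f B"
    using om by (auto simp: outer_measure_space_def increasing_def)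
  finally show ?thesis by (simp add: Un_commute)
qed

lemma sum_even_odd:
  fixes g :: "nat \<Rightarrow> 'b::comm_monoid_add"
  shows "sum g {..<2 * n} = (\<Sum>k<n. g (2 * k)) + (\<Sum>k<n. g (2 * k + 1))"
  by (induction n) (simp_all add: ac_simps)

text \<open>
  Given \<open>C\<close> and a test set \<open>A\<close>, the part \<open>An n\<close> of \<open>A\<close> at distance at least \<open>1/(n+1)\<close> from \<open>C\<close>
  is separated from \<open>C\<close>, and what \<open>An n\<close> misses of \<open>A - C\<close> is the union of the rings \<open>R k\<close> with \<open>k \<ge> n\<close>.
  Two rings that are not adjacent are separated, so the even rings, and likewise the odd ones, have
  total measure at most \<open>f A\<close>. Hence the series of all rings converges and its tail is negligible.
\<close>

lemma caratheodory_criterion: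
  fixes f :: "'a::metric_space set \<Rightarrow> ennreal"
  assumes om: "outer_measure_space (Pow UNIV) f"
    and sep: "\<And>A B r. 0 < r \<Longrightarrow> (\<And>a b. a \<in> A \<Longrightarrow> b \<in> B \<Longrightarrow> r \<le> dist a b) \<Longrightarrow> f A + f B \<le> f (A \<union> B)"
    and "closed C"
  shows "C \<in> lambda_system UNIV (Pow UNIV) f"
proof -
  have mono: "f A \<le> f B" if "A \<subseteq> B" for A B
    using om that by (auto simp: outer_measure_space_def increasing_def)
  have empty: "f {} = 0"
    using om by (auto simp: outer_measure_space_def positive_def)
  have main: "f (C \<inter> A) + f (A - C) \<le> f A" if "C \<noteq> {}" and fin: "f A \<noteq> \<infinity>" for A
  proof -
    define d where "d x = infdist x C" for x
    define An where "An n = {x \<in> A. 1 / (real n + 1) \<le> d x}" for n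
    define R where "R n = {x \<in> A. 1 / (real n + 2) \<le> d x \<and> d x < 1 / (real n + 1)}" for n
    have lip: "d x \<le> d y + dist x y" for x y
      unfolding d_def by (metis add.commute dist_commute infdist_triangle)
    have dpos: "0 < d x" if "x \<notin> C" for x
      using \<open>closed C\<close> \<open>C \<noteq> {}\<close> that unfolding d_def
      by (metis in_closed_iff_infdist_zero infdist_nonneg less_eq_real_def)
    have d0: "d x = 0" if "x \<in> C" for x
      using that unfolding d_def by simp
    have rings: "(\<Sum>k<n. f (R (2 * k + j))) \<le> f (\<Union>k<n. R (2 * k + j))" for n j
    proof (induction n)
      case (Suc n)
      have "(\<Sum>k<Suc n. f (R (2 * k + j))) = (\<Sum>k<n. f (R (2 * k + j))) + f (R (2 * n + j))"
        by simp
      also have "\<dots> \<le> f (\<Union>k<n. R (2 * k + j)) + f (R (2 * n + j))"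
        by (rule add_right_mono[OF Suc])
      also have "f (\<Union>k<n. R (2 * k + j)) + f (R (2 * n + j))
          \<le> f ((\<Union>k<n. R (2 * k + j)) \<union> R (2 * n + j))"
      proof (cases "n = 0")
        case False
        \<comment> \<open>The distance to \<open>C\<close> is at least \<open>1 / (2 * n + j)\<close> on the earlier rings and less than \<open>1 / (2 * n + j + 1)\<close> on the new one.\<close>
        define r where "r = 1 / real (2 * n + j) - 1 / real (2 * n + j + 1)"
        show ?thesis
        proof (rule sep)
          have "1 / real (2 * n + j + 1) < 1 / real (2 * n + j)"
            using False by (intro divide_strict_left_mono) auto
          then show "0 < r" by (simp add: r_def)
          fix a b assume a: "a \<in> (\<Union>k<n. R (2 * k + j))" and b: "b \<in> R (2 * n + j)"
          from a obtain k where k: "k < n" "1 / real (2 * k + j + 2) \<le> d a"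
            by (auto simp: R_def add.commute)
          have "1 / real (2 * n + j) \<le> 1 / real (2 * k + j + 2)"
            using k(1) by (intro divide_left_mono) auto
          moreover have "d b < 1 / real (2 * n + j + 1)"
            using b by (auto simp: R_def add.commute)
          ultimately show "r \<le> dist a b"
            using k(2) lip[of a b] by (simp add: r_def)
        qed
      qed (simp add: empty)
      also have "(\<Union>k<n. R (2 * k + j)) \<union> R (2 * n + j) = (\<Union>k<Suc n. R (2 * k + j))"
        by (auto simp: lessThan_Suc)
      finally show ?case .
    qed simp
    define S where "S = (\<Sum>i. f (R i))"
    have "S \<le> f A + f A"
      unfolding S_def
    proof (rule suminf_le_const)
      fix n
      have "(\<Sum>i<n. f (R i)) \<le> (\<Sum>i<2 * n. f (R i))" by (rule sum_mono2) auto
      also have "\<dots> = (\<Sum>k<n. f (R (2 * k + 0))) + (\<Sum>k<n. f (R (2 * k + 1)))"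
        by (simp add: sum_even_odd)
      also have "\<dots> \<le> f A + f A"
        by (intro add_mono order_trans[OF rings] mono) (auto simp: R_def)
      finally show "(\<Sum>i<n. f (R i)) \<le> f A + f A" .
    qed simp
    then have Sfin: "S \<noteq> \<infinity>" using fin
      by (metis ennreal_add_eq_top infinity_ennreal_def top.extremum_unique)
    \<comment> \<open>Adding the first \<open>n\<close> rings to both sides turns the tail of the series into the finite total \<open>S\<close>, which can be cancelled in the limit.\<close>
    have step: "f (C \<inter> A) + f (A - C) + (\<Sum>i<n. f (R i)) \<le> f A + S" for n
    proof -
      have cover: "A - C = An n \<union> (\<Union>k. R (k + n))"
      proof (intro set_eqI iffI)
        fix x assume x: "x \<in> A - C"
        have ex: "\<exists>m. 1 / (real m + 1) \<le> d x"
          using dpos[of x] x reals_Archimedean[of "d x"] by (auto simp: inverse_eq_divide add.commute intro: less_imp_le)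
        define m where "m = (LEAST m. 1 / (real m + 1) \<le> d x)"
        have m: "1 / (real m + 1) \<le> d x" unfolding m_def by (rule LeastI_ex[OF ex])
        show "x \<in> An n \<union> (\<Union>k. R (k + n))"
        proof (cases "m \<le> n")
          case True
          have "1 / (real n + 1) \<le> 1 / (real m + 1)" using True by (simp add: frac_le)
          then show ?thesis using m x by (auto simp: An_def)
        next
          case False
          then have "d x < 1 / (real (m - 1) + 1)"
            using not_less_Least[of "m - 1" "\<lambda>m. 1 / (real m + 1) \<le> d x"] unfolding m_def[symmetric] by linarith
          then have "x \<in> R ((m - 1 - n) + n)"
            using m x False by (auto simp: R_def add.commute)
          then show ?thesis by blast
        qed
      next
        fix x assume "x \<in> An n \<union> (\<Union>k. R (k + n))"
        then consider "x \<in> A" "1 / (real n + 1) \<le> d x" | k where "x \<in> A" "1 / (real (k + n) + 2) \<le> d x"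
          by (auto simp: An_def R_def)
        then have "x \<in> A \<and> 0 < d x"
        proof cases
          case 1
          then show ?thesis using less_le_trans[of 0 "1 / (real n + 1)" "d x"] by simp
        next
          case (2 k)
          then show ?thesis using less_le_trans[of 0 "1 / (real (k + n) + 2)" "d x"] by simp
        qed
        then show "x \<in> A - C" using d0[of x] by auto
      qed
      have disj: "disjoint_family (\<lambda>k. R (k + n))"
      proof -
        have "R i \<inter> R j = {}" if "i < j" for i j
        proof -
          have "1 / (real j + 1) \<le> 1 / (real i + 2)" using that by (simp add: frac_le)
          then show ?thesis by (auto simp: R_def)
        qed
        then show ?thesis unfolding disjoint_family_on_def
          by (metis add_right_cancel Int_commute linorder_neqE_nat)
      qed
      have "f (A - C) \<le> f (An n) + f (\<Union>k. R (k + n))"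
        unfolding cover by (rule outer_measure_space_subadd[OF om])
      also have "f (\<Union>k. R (k + n)) \<le> (\<Sum>k. f (R (k + n)))"
        using om disj by (auto simp: outer_measure_space_def countably_subadditive_def)
      finally have "f (C \<inter> A) + f (A - C) + (\<Sum>i<n. f (R i))
          \<le> (f (C \<inter> A) + f (An n)) + ((\<Sum>k. f (R (k + n))) + (\<Sum>i<n. f (R i)))"
        by (simp add: add.assoc add_left_mono add_right_mono add_mono)
      also have "(\<Sum>k. f (R (k + n))) + (\<Sum>i<n. f (R i)) = S"
        unfolding S_def using suminf_offset[of "\<lambda>i. f (R i)" n] by (simp add: add.commute)
      also have "f (C \<inter> A) + f (An n) \<le> f A"
      proof -
        have "f (C \<inter> A) + f (An n) \<le> f ((C \<inter> A) \<union> An n)"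
        proof (rule sep)
          show "0 < 1 / (real n + 1)" by simp
          fix a b assume "a \<in> C \<inter> A" "b \<in> An n"
          then show "1 / (real n + 1) \<le> dist a b"
            using lip[of b a] d0[of a] by (auto simp: An_def dist_commute)
        qed
        also have "\<dots> \<le> f A" by (rule mono) (auto simp: An_def)
        finally show ?thesis .
      qed
      finally show ?thesis by (simp add: add_right_mono)
    qed
    have "(f (C \<inter> A) + f (A - C)) + S = (SUP n. f (C \<inter> A) + f (A - C) + (\<Sum>i<n. f (R i)))"
      unfolding S_def suminf_eq_SUP by (rule ennreal_SUP_add_right) simp
    also have "\<dots> \<le> f A + S" by (rule SUP_least) (rule step)
    finally show ?thesis using Sfin
      by (metis add.commute ennreal_add_left_cancel_le infinity_ennreal_def)
  qed
  have "f (C \<inter> A) + f ((UNIV - C) \<inter> A) = f A" for A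
  proof (rule antisym)
    have eq: "(UNIV - C) \<inter> A = A - C" by auto
    show "f (C \<inter> A) + f ((UNIV - C) \<inter> A) \<le> f A"
      unfolding eq using main[of A] empty by (cases "C = {}"; cases "f A = \<infinity>") auto
    have "A = C \<inter> A \<union> (UNIV - C) \<inter> A" by auto
    then show "f A \<le> f (C \<inter> A) + f ((UNIV - C) \<inter> A)"
      using outer_measure_space_subadd[OF om, of "C \<inter> A" "(UNIV - C) \<inter> A"] by simp
  qed
  then show ?thesis by (auto simp: lambda_system_def)
qed

text \<open>
  A covering set of diameter at most \<open>\<delta>\<close> cannot meet both \<open>A\<close> and \<open>B\<close>, so every cover of the union splits
  into a cover of \<open>A\<close> and a cover of \<open>B\<close>.
\<close>

lemma hausdorff_content_separated:
  fixes A B :: "'a::metric_space set"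
  assumes s: "0 < s" and "\<delta> < r" and far: "\<And>a b. a \<in> A \<Longrightarrow> b \<in> B \<Longrightarrow> r \<le> dist a b"
  shows "outer_measure (Pow UNIV) (hausdorff_weight s \<delta>) A + outer_measure (Pow UNIV) (hausdorff_weight s \<delta>) B
    \<le> outer_measure (Pow UNIV) (hausdorff_weight s \<delta>) (A \<union> B)"
  unfolding outer_measure_def[of _ _ "A \<union> B"]
proof (rule INF_greatest)
  let ?w = "hausdorff_weight s \<delta> :: 'a set \<Rightarrow> ennreal"
  fix E :: "nat \<Rightarrow> 'a set"
  assume E: "E \<in> {E. range E \<subseteq> Pow UNIV \<and> disjoint_family E \<and> A \<union> B \<subseteq> (\<Union>i. E i)}"
  define T where "T X i = (if E i \<inter> X = {} then {} else E i)" for X i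
  \<comment> \<open>For \<open>\<delta> < 0\<close> every set, even the empty one, has infinite weight.\<close>
  have w0: "?w {} = 0 \<or> \<delta> < 0" using s by (auto simp: hausdorff_weight_def)
  have le: "outer_measure (Pow UNIV) ?w X \<le> (\<Sum>i. ?w (T X i))" if "X \<subseteq> A \<union> B" for X
    unfolding outer_measure_def
    by (rule INF_lower) (use E that in \<open>auto simp: T_def disjoint_family_on_def subset_eq; blast\<close>)
  have split: "?w (T A i) + ?w (T B i) \<le> ?w (E i)" for i
  proof (cases "\<delta> < 0")
    case True
    then have "?w (E i) = \<infinity>"
      using diameter_ge_0[of "E i"] by (auto simp: hausdorff_weight_def)
    then show ?thesis by simp
  next
    case False
    show ?thesis
    proof (cases "E i \<inter> A = {} \<or> E i \<inter> B = {}")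
      case True
      then show ?thesis using w0 False by (auto simp: T_def)
    next
      case F: False
      then obtain a b where ab: "a \<in> E i" "a \<in> A" "b \<in> E i" "b \<in> B" by auto
      have "?w (E i) = \<infinity>"
        using diameter_bounded_bound[of "E i" a b] far[of a b] ab \<open>\<delta> < r\<close>
        by (auto simp: hausdorff_weight_def)
      then show ?thesis by simp
    qed
  qed
  have "outer_measure (Pow UNIV) ?w A + outer_measure (Pow UNIV) ?w B
      \<le> (\<Sum>i. ?w (T A i)) + (\<Sum>i. ?w (T B i))"
    by (intro add_mono le) auto
  also have "\<dots> = (\<Sum>i. ?w (T A i) + ?w (T B i))" by (rule suminf_add) auto
  also have "\<dots> \<le> (\<Sum>i. ?w (E i))" by (intro suminf_le split) auto
  finally show "outer_measure (Pow UNIV) ?w A + outer_measure (Pow UNIV) ?w B \<le> (\<Sum>i. ?w (E i))" .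
qed

lemma hausdorff_content_antimono:
  assumes "\<delta> \<le> \<epsilon>"
  shows "outer_measure (Pow UNIV) (hausdorff_weight s \<epsilon>) A \<le> outer_measure (Pow UNIV) (hausdorff_weight s \<delta>) A"
  unfolding outer_measure_def
  by (intro INF_superset_mono order_refl suminf_le) (use assms in \<open>auto simp: hausdorff_weight_def\<close>)

lemma hausdorff_outer_separated:
  fixes A B :: "'a::metric_space set"
  assumes s: "0 < s" and "0 < r" and far: "\<And>a b. a \<in> A \<Longrightarrow> b \<in> B \<Longrightarrow> r \<le> dist a b"
  shows "hausdorff_outer s A + hausdorff_outer s B \<le> hausdorff_outer s (A \<union> B)"
proof -
  let ?H = "\<lambda>\<delta>. outer_measure (Pow UNIV) (hausdorff_weight s \<delta> :: 'a set \<Rightarrow> ennreal)"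
  have "?H \<delta> A + ?H \<epsilon> B \<le> hausdorff_outer s (A \<union> B)" if "0 < \<delta>" "0 < \<epsilon>" for \<delta> \<epsilon>
  proof -
    define \<eta> where "\<eta> = min (min \<delta> \<epsilon>) (r / 2)"
    have \<eta>: "0 < \<eta>" "\<eta> \<le> \<delta>" "\<eta> \<le> \<epsilon>" "\<eta> < r" using that \<open>0 < r\<close> by (auto simp: \<eta>_def)
    have "?H \<delta> A + ?H \<epsilon> B \<le> ?H \<eta> A + ?H \<eta> B"
      by (intro add_mono hausdorff_content_antimono \<eta>)
    also have "\<dots> \<le> ?H \<eta> (A \<union> B)"
      by (rule hausdorff_content_separated[OF s \<eta>(4) far])
    also have "\<dots> \<le> hausdorff_outer s (A \<union> B)"
      unfolding hausdorff_outer_def using \<eta>(1) by (intro SUP_upper) auto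
    finally show ?thesis .
  qed
  then have "?H \<delta> A + hausdorff_outer s B \<le> hausdorff_outer s (A \<union> B)" if "0 < \<delta>" for \<delta>
    unfolding hausdorff_outer_def[of s B] using that
    by (subst ennreal_SUP_add_right) (auto intro!: SUP_least exI[of _ "1::real"])
  then show ?thesis
    unfolding hausdorff_outer_def[of s A]
    by (subst ennreal_SUP_add_left[symmetric]) (auto intro!: SUP_least exI[of _ "1::real"])
qed

lemma borel_subset_hausdorff_measure:
  assumes s: "0 < s"
  shows "sets borel \<subseteq> sets (hausdorff_measure s :: 'a::metric_space measure)"
proof -
  let ?M = "hausdorff_measure s :: 'a measure"
  have space: "space ?M = UNIV" unfolding hausdorff_measure_def
    by (rule space_measure_of) auto
  have closed: "C \<in> sets ?M" if "closed C" for C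
    unfolding sets_hausdorff_measure[OF s]
    by (rule caratheodory_criterion[OF outer_measure_space_hausdorff[OF s] hausdorff_outer_separated[OF s] that])
  have "sigma_sets UNIV {C. closed C} \<subseteq> sets ?M"
    using closed sets.sigma_sets_subset[of "Collect closed" ?M] by (auto simp: space)
  then show ?thesis by (simp add: borel_eq_closed)
qed

section \<open>Surface measure of the faces of a cell\<close>

lemma outer_measure_space_UN_le:
  assumes om: "outer_measure_space (Pow UNIV) f" and "finite I"
  shows "f (\<Union>i\<in>I. A i) \<le> (\<Sum>i\<in>I. f (A i))"
  using \<open>finite I\<close>
proof induction
  case empty
  then show ?case using om by (auto simp: outer_measure_space_def positive_def)
next
  case (insert i I)
  have "f (\<Union>i\<in>insert i I. A i) \<le> f (A i) + f (\<Union>i\<in>I. A i)"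
    using outer_measure_space_subadd[OF om, of "A i" "\<Union>i\<in>I. A i"] by simp
  also have "\<dots> \<le> f (A i) + (\<Sum>i\<in>I. f (A i))" by (intro add_left_mono insert.IH)
  finally show ?case using insert by simp
qed

lemma hausdorff_content_cover_le:
  fixes A :: "'a::metric_space set"
  assumes "0 < s" "0 < \<delta>" and "finite I" and cover: "A \<subseteq> (\<Union>i\<in>I. Q i)"
    and Q: "\<And>i. i \<in> I \<Longrightarrow> bounded (Q i) \<and> diameter (Q i) \<le> r" and "r \<le> \<delta>"
  shows "outer_measure (Pow UNIV) (hausdorff_weight s \<delta>) A
    \<le> of_nat (card I) * ennreal (unit_ball_vol (real s) * (r / 2) ^ s)"
proof -
  interpret sigma_algebra UNIV "Pow UNIV :: 'a set set" by (rule sigma_algebra_Pow)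
  let ?w = "hausdorff_weight s \<delta> :: 'a set \<Rightarrow> ennreal"
  let ?H = "outer_measure (Pow UNIV) ?w"
  have pos: "positive (Pow UNIV) ?w" by (rule positive_hausdorff_weight) fact+
  have inc: "increasing (Pow UNIV) ?w" by (rule increasing_hausdorff_weight)
  have om: "outer_measure_space (Pow UNIV) ?H"
    by (rule outer_measure_space_outer_measure[OF pos inc])
  have "?H A \<le> ?H (\<Union>i\<in>I. Q i)"
    using om cover by (auto simp: outer_measure_space_def increasing_def)
  also have "\<dots> \<le> (\<Sum>i\<in>I. ?H (Q i))" by (rule outer_measure_space_UN_le[OF om \<open>finite I\<close>])
  also have "\<dots> \<le> (\<Sum>i\<in>I. ennreal (unit_ball_vol (real s) * (r / 2) ^ s))"
  proof (rule sum_mono)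
    fix i assume i: "i \<in> I"
    have "?H (Q i) \<le> (\<Sum>k::nat. ?w (if k = 0 then Q i else {}))"
      by (rule outer_measure_le[OF pos inc]) auto
    also have "\<dots> = ?w (Q i)"
      using pos by (subst suminf_finite[of "{0}"]) (auto simp: positive_def)
    also have "\<dots> \<le> ennreal (unit_ball_vol (real s) * (r / 2) ^ s)"
      using Q[OF i] \<open>r \<le> \<delta>\<close> diameter_ge_0[of "Q i"]
      by (auto simp: hausdorff_weight_def intro!: ennreal_leI mult_left_mono power_mono)
    finally show "?H (Q i) \<le> ennreal (unit_ball_vol (real s) * (r / 2) ^ s)" .
  qed
  finally show ?thesis by simp
qed

text \<open>
  The right end \<open>t = h\<close> belongs to the last of the \<open>N\<close> closed subintervals; elsewhere rounding down works.
\<close>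

lemma subinterval_containing:
  fixes t h :: real and N :: nat
  assumes "0 < N" "0 < h" "0 \<le> t" "t \<le> h"
  shows "\<exists>k<N. h * real k / real N \<le> t \<and> t \<le> h * (real k + 1) / real N"
proof (cases "t = h")
  case True
  then show ?thesis using assms by (intro exI[of _ "N - 1"]) (auto simp: field_simps of_nat_diff)
next
  case False
  define k where "k = nat \<lfloor>t * N / h\<rfloor>"
  have nn: "0 \<le> t * N / h" using assms by simp
  then have k: "real k \<le> t * N / h" "t * N / h < real k + 1"
    unfolding k_def by (auto simp: of_nat_nat)
  have "t * N / h < N" using False assms by (simp add: field_simps)
  then have "k < N" using k(1) by linarith
  then show ?thesis using k assms by (intro exI[of _ k]) (auto simp: field_simps)
qed

text \<open>
  For each \<open>N\<close> the slice is covered by \<open>N\<^sup>d\<^sup>-\<^sup>1\<close> boxes of diameter at most \<open>d * h / N\<close>. The factor \<open>N\<^sup>d\<^sup>-\<^sup>1\<close>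
  cancels in the total weight, which is therefore bounded uniformly in the mesh size of the cover.
\<close>

lemma hausdorff_outer_cube_slice_finite:
  fixes a :: "real^'n"
  assumes s: "s = CARD('n) - 1" "0 < s" and "0 < h"
  shows "hausdorff_outer s {x \<in> cube a h. x $ i = c} < \<infinity>"
proof -
  let ?F = "{x \<in> cube a h. x $ i = c}"
  let ?d = "real CARD('n)"
  let ?B = "ennreal (unit_ball_vol (real s) * (?d * h / 2) ^ s)"
  have "outer_measure (Pow UNIV) (hausdorff_weight s \<delta>) ?F \<le> ?B" if "0 < \<delta>" for \<delta>
  proof -
    obtain N :: nat where "?d * h / \<delta> < N" using reals_Archimedean2 by blast
    moreover have "0 < ?d * h / \<delta>" using \<open>0 < h\<close> that by simp
    ultimately have "0 < real N" "?d * h < \<delta> * real N"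
      using that by (linarith, simp add: field_simps)
    then have N: "0 < N" "?d * h / N \<le> \<delta>"
      by (simp_all add: field_simps)
    define I where "I = (UNIV - {i}) \<rightarrow>\<^sub>E {..<N}"
    define Q where "Q \<phi> = {x :: real^'n. x $ i = c \<and>
      (\<forall>j. j \<noteq> i \<longrightarrow> a $ j + h * real (\<phi> j) / N \<le> x $ j \<and> x $ j \<le> a $ j + h * (real (\<phi> j) + 1) / N)}" for \<phi>
    have cI: "finite I" "card I = N ^ s"
      unfolding I_def by (auto simp: card_PiE card_Diff_singleton s intro!: finite_PiE)
    have cover: "?F \<subseteq> (\<Union>\<phi>\<in>I. Q \<phi>)"
    proof
      fix x assume x: "x \<in> ?F"
      have "\<exists>k<N. h * real k / N \<le> x $ j - a $ j \<and> x $ j - a $ j \<le> h * (real k + 1) / N" for j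
        using x N(1) \<open>0 < h\<close> by (intro subinterval_containing) (auto simp: cube_def mem_box_cart algebra_simps)
      then obtain \<phi> where \<phi>: "\<And>j. \<phi> j < N"
        "\<And>j. h * real (\<phi> j) / N \<le> x $ j - a $ j \<and> x $ j - a $ j \<le> h * (real (\<phi> j) + 1) / N"
        by metis
      have "x \<in> Q (restrict \<phi> (UNIV - {i}))"
        using x \<phi>(2) by (auto simp: Q_def algebra_simps)
      moreover have "restrict \<phi> (UNIV - {i}) \<in> I" using \<phi>(1) by (auto simp: I_def)
      ultimately show "x \<in> (\<Union>\<phi>\<in>I. Q \<phi>)" by blast
    qed
    have dist: "norm (x - y) \<le> ?d * h / N" if "x \<in> Q \<phi>" "y \<in> Q \<phi>" for x y \<phi>
    proof -
      have "norm (x - y) \<le> (\<Sum>j\<in>UNIV. \<bar>(x - y) $ j\<bar>)" by (rule norm_le_l1_cart)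
      also have "\<dots> \<le> (\<Sum>j\<in>(UNIV::'n set). h / N)"
      proof (rule sum_mono)
        fix j
        show "\<bar>(x - y) $ j\<bar> \<le> h / N"
        proof (cases "j = i")
          case True then show ?thesis using that \<open>0 < h\<close> by (simp add: Q_def)
        next
          case False
          then have "a $ j + h * real (\<phi> j) / N \<le> x $ j \<and> x $ j \<le> a $ j + h * (real (\<phi> j) + 1) / N"
            "a $ j + h * real (\<phi> j) / N \<le> y $ j \<and> y $ j \<le> a $ j + h * (real (\<phi> j) + 1) / N"
            using that by (auto simp: Q_def)
          moreover have "h * (real (\<phi> j) + 1) / N = h * real (\<phi> j) / N + h / N"
            by (simp add: distrib_left add_divide_distrib)
          ultimately show ?thesis by (simp add: abs_le_iff)
        qed
      qed
      finally show ?thesis by simp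
    qed
    have diam: "bounded (Q \<phi>) \<and> diameter (Q \<phi>) \<le> ?d * h / N" for \<phi>
    proof
      show "bounded (Q \<phi>)"
        unfolding bounded_two_points dist_norm using dist by blast
      show "diameter (Q \<phi>) \<le> ?d * h / N"
        using dist \<open>0 < h\<close> by (intro diameter_le) auto
    qed
    have "outer_measure (Pow UNIV) (hausdorff_weight s \<delta>) ?F
        \<le> of_nat (card I) * ennreal (unit_ball_vol (real s) * (?d * h / N / 2) ^ s)"
      by (rule hausdorff_content_cover_le[OF s(2) that cI(1) cover diam N(2)])
    also have "\<dots> = ennreal (real (N ^ s) * (unit_ball_vol (real s) * (?d * h / N / 2) ^ s))"
      using \<open>0 < h\<close> by (simp add: cI ennreal_mult ennreal_of_nat_eq_real_of_nat)
    also have "real (N ^ s) * (unit_ball_vol (real s) * (?d * h / N / 2) ^ s)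
        = unit_ball_vol (real s) * (?d * h / 2) ^ s"
      using N(1) by (simp add: power_divide)
    finally show ?thesis .
  qed
  then have "hausdorff_outer s ?F \<le> ?B"
    unfolding hausdorff_outer_def by (intro SUP_least) auto
  then show ?thesis
    by (rule le_less_trans) simp
qed

lemma closed_cube: "closed (cube a h)"
  by (simp add: cube_def closed_cbox)

lemma
  fixes F :: "(real^'n) \<times> 'n"
  assumes n: "2 \<le> CARD('n)" and h: "0 < h"
  shows face_set_measurable: "face_set h F \<in> sets surface_measure"
    and emeasure_face_set_finite: "emeasure surface_measure (face_set h F) < \<infinity>"
proof -
  obtain a i where F: "F = (a, i)" by fastforce
  let ?M = "hausdorff_measure (CARD('n) - 1) :: (real^'n) measure"
  have s: "0 < CARD('n) - 1" using n by simp
  have "closed (face_set h F)"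
    unfolding F face_set_def by (auto simp: closed_cube)
  then have meas: "face_set h F \<in> sets ?M"
    using borel_subset_hausdorff_measure[OF s] borel_closed by blast
  then show "face_set h F \<in> sets surface_measure" by (simp add: surface_measure_def)
  let ?S = "{x \<in> cube a h. x $ i = a $ i + h}"
  have sub: "face_set h F \<subseteq> ?S"
  proof
    fix x assume "x \<in> face_set h F"
    then have x: "x \<in> cube a h" "x \<in> cube (a + axis i h) h" by (auto simp: F face_set_def)
    then have "x $ i \<le> a $ i + h" "(a + axis i h) $ i \<le> x $ i"
      by (auto simp: cube_def mem_box_cart simp del: vector_add_component)
    then show "x \<in> ?S" using x(1) by (simp add: axis_def)
  qed
  have "emeasure ?M (face_set h F) = hausdorff_outer (CARD('n) - 1) (face_set h F)"
    by (rule emeasure_hausdorff_measure[OF s meas])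
  also have "\<dots> \<le> hausdorff_outer (CARD('n) - 1) ?S"
    using outer_measure_space_hausdorff[OF s, where 'a = "real^'n"] sub
    by (auto simp: outer_measure_space_def increasing_def)
  also have "\<dots> < \<infinity>" by (rule hausdorff_outer_cube_slice_finite[OF refl s h])
  finally show "emeasure surface_measure (face_set h F) < \<infinity>" by (simp add: surface_measure_def)
qed

lemma surface_inner_self_nonneg: "0 \<le> surface_inner S u u"
  unfolding surface_inner_def set_lebesgue_integral_def
  by (rule integral_nonneg_AE) (auto simp: indicator_def)

text \<open>
  Continuity of \<open>j\<close> makes its square integrable over the larger face, where the integral would otherwise
  be 0 by convention and monotonicity would fail.
\<close>

lemma surface_inner_face_mono:
  fixes F G :: "(real^'n) \<times> 'n"
  assumes n: "2 \<le> CARD('n)" and h: "0 < h" "0 < k" and j: "continuous_on UNIV j"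
    and sub: "face_set h F \<subseteq> face_set k G"
  shows "surface_inner (face_set h F) j j \<le> surface_inner (face_set k G) j j"
proof -
  let ?M = "surface_measure :: (real^'n) measure"
  have "sets borel \<subseteq> sets ?M"
    unfolding surface_measure_def using n by (intro borel_subset_hausdorff_measure) simp
  moreover have "(\<lambda>x. j x * j x) \<in> borel_measurable borel"
    using j by (intro borel_measurable_continuous_onI continuous_intros)
  moreover have "space ?M = UNIV"
    unfolding surface_measure_def hausdorff_measure_def by (rule space_measure_of) auto
  ultimately have meas: "(\<lambda>x. j x * j x) \<in> borel_measurable ?M"
    unfolding measurable_def by auto
  have int: "integrable ?M (\<lambda>x. indicator (face_set r E) x *\<^sub>R (j x * j x))" if "0 < r" for r E
  proof -
    have "compact (face_set r E)"
      unfolding face_set_def cube_def by (auto split: prod.split)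
    then have "bounded ((\<lambda>x. j x * j x) ` face_set r E)"
      using j by (intro compact_imp_bounded compact_continuous_image continuous_intros)
        (auto intro: continuous_on_subset)
    then obtain B where B: "\<And>x. x \<in> face_set r E \<Longrightarrow> norm (j x * j x) \<le> B"
      by (auto simp: bounded_iff)
    show ?thesis
      using face_set_measurable[OF n that, of E] emeasure_face_set_finite[OF n that, of E] meas B
      by (intro integrableI_bounded_set_indicator[where B = B]) auto
  qed
  show ?thesis
    unfolding surface_inner_def set_lebesgue_integral_def
    using sub by (intro integral_mono int h) (auto simp: indicator_def)
qed

section \<open>Tensor-product polynomials on a cell\<close>

lemma Qpoly_diff:
  assumes "q \<in> Qpoly p" "r \<in> Qpoly p"
  shows "(\<lambda>x. q x - r x) \<in> Qpoly p"
proof -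
  obtain c d where "q = (\<lambda>x. \<Sum>\<alpha> | \<forall>i. \<alpha> i \<le> p. c \<alpha> * (\<Prod>i\<in>UNIV. (x $ i) ^ \<alpha> i))"
    "r = (\<lambda>x. \<Sum>\<alpha> | \<forall>i. \<alpha> i \<le> p. d \<alpha> * (\<Prod>i\<in>UNIV. (x $ i) ^ \<alpha> i))"
    using assms by (auto simp: Qpoly_def)
  then show ?thesis
    unfolding Qpoly_def by (auto simp: sum_subtractf left_diff_distrib intro!: exI[of _ "\<lambda>\<alpha>. c \<alpha> - d \<alpha>"])
qed

lemma Qpoly_line:
  assumes "q \<in> Qpoly p"
  shows "\<exists>P. \<forall>t. q (y + t *\<^sub>R d) = poly P t"
proof -
  obtain c where q: "q = (\<lambda>x. \<Sum>\<alpha> | \<forall>i. \<alpha> i \<le> p. c \<alpha> * (\<Prod>i\<in>UNIV. (x $ i) ^ \<alpha> i))"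
    using assms by (auto simp: Qpoly_def)
  show ?thesis
    by (intro exI[of _ "\<Sum>\<alpha> | \<forall>i. \<alpha> i \<le> p. smult (c \<alpha>) (\<Prod>i\<in>UNIV. [:y $ i, d $ i:] ^ \<alpha> i)"])
      (simp add: q poly_sum poly_prod poly_power)
qed

text \<open>
  Join an arbitrary point to the centre of the cube. Along this line the difference of the two polynomials is
  a univariate polynomial with infinitely many zeros, so it is zero.
\<close>

lemma Qpoly_eq_if_eq_on_cube:
  fixes a :: "real^'n"
  assumes "0 < h" and "q \<in> Qpoly p" "r \<in> Qpoly p" and eq: "\<And>x. x \<in> cube a h \<Longrightarrow> q x = r x"
  shows "q = r"
proof
  fix z
  define m :: "real^'n" where "m = (\<chi> i. a $ i + h / 2)"
  obtain P where P: "\<And>t. q (m + t *\<^sub>R (z - m)) - r (m + t *\<^sub>R (z - m)) = poly P t"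
    using Qpoly_line[OF Qpoly_diff[OF assms(2,3)]] by metis
  have "m \<in> box a (\<chi> i. a $ i + h)" using \<open>0 < h\<close> by (simp add: m_def mem_box_cart)
  then have zero: "0 \<in> (\<lambda>t::real. m + t *\<^sub>R (z - m)) -` box a (\<chi> i. a $ i + h)"
    by simp
  have "open ((\<lambda>t::real. m + t *\<^sub>R (z - m)) -` box a (\<chi> i. a $ i + h))"
    by (intro open_vimage open_box continuous_intros)
  then obtain e where e: "0 < e" "\<And>t. dist t 0 < e \<Longrightarrow> m + t *\<^sub>R (z - m) \<in> box a (\<chi> i. a $ i + h)"
    using zero unfolding open_dist by (metis vimage_eq)
  have root: "poly P t = 0" if "t \<in> {0<..<e}" for t
  proof -
    have "m + t *\<^sub>R (z - m) \<in> cube a h"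
      using e(2)[of t] that box_subset_cbox by (auto simp: cube_def)
    then show ?thesis using eq P[of t] by simp
  qed
  have "infinite {t. poly P t = 0}"
    using infinite_Ioo[OF e(1)] root by (metis (mono_tags, lifting) finite_subset mem_Collect_eq subsetI)
  then have "P = 0" using poly_roots_finite by blast
  then show "q z = r z" using P[of 1] by simp
qed

lemma cell_poly_eq:
  assumes "0 < h" "q \<in> Qpoly p" "\<And>x. x \<in> cube a h \<Longrightarrow> v x = q x"
  shows "cell_poly p (cube a h) v = q"
  unfolding cell_poly_def
proof (rule the_equality)
  show "q \<in> Qpoly p \<and> (\<forall>x\<in>cube a h. v x = q x)" using assms by auto
  show "r = q" if "r \<in> Qpoly p \<and> (\<forall>x\<in>cube a h. v x = r x)" for r
    by (rule Qpoly_eq_if_eq_on_cube[OF assms(1), where p = p and a = a]) (use assms that in auto)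
qed

text \<open>
  Differentiating a monomial in direction \<open>i\<close> acts only on the factor \<open>x\<^sub>i\<close>, so the \<open>k\<close>-th derivative is
  the explicit polynomial \<open>D k\<close>.
\<close>

lemma continuous_cell_normal_deriv:
  assumes "cell_poly p K v \<in> Qpoly p"
  shows "continuous_on UNIV (cell_normal_deriv p k i K v)"
proof -
  obtain c where q: "cell_poly p K v = (\<lambda>x. \<Sum>\<alpha> | \<forall>i. \<alpha> i \<le> p. c \<alpha> * (\<Prod>i\<in>UNIV. (x $ i) ^ \<alpha> i))"
    using assms by (auto simp: Qpoly_def)
  define D where "D k x = (\<Sum>\<alpha> | \<forall>i. \<alpha> i \<le> p.
      c \<alpha> * (\<Prod>j\<in>UNIV - {i}. (x $ j) ^ \<alpha> j) * poly ((pderiv ^^ k) (monom 1 (\<alpha> i))) (x $ i))"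
    for k and x :: "real^'a"
  have D0: "cell_poly p K v = D 0"
    unfolding q D_def by (rule ext) (simp add: prod.remove[of UNIV i] poly_monom ac_simps)
  have line: "D k (x + axis i t) = (\<Sum>\<alpha> | \<forall>i. \<alpha> i \<le> p.
      c \<alpha> * (\<Prod>j\<in>UNIV - {i}. (x $ j) ^ \<alpha> j) * poly ((pderiv ^^ k) (monom 1 (\<alpha> i))) (x $ i + t))" for k x t
    unfolding D_def by (intro sum.cong refl arg_cong2[of _ _ _ _ "(*)"] prod.cong) (auto simp: axis_def)
  have DERIV: "((\<lambda>t. D k (x + axis i t)) has_field_derivative D (Suc k) (x + axis i t)) (at t)" for k x t
    unfolding line
    by (auto intro!: derivative_eq_intros sum.cong )
  have "(deriv ^^ k) (\<lambda>t. D 0 (x + axis i t)) = (\<lambda>t. D k (x + axis i t))" for x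
    by (induction k) (auto intro!: DERIV_imp_deriv DERIV)
  then have "cell_normal_deriv p k i K v = D k"
    unfolding cell_normal_deriv_def D0 by (auto simp: axis_def zero_vec_def[symmetric] fun_eq_iff)
  then show ?thesis
    unfolding D_def by (auto intro!: continuous_intros)
qed

section \<open>Cartesian grids and their refinement\<close>

lemma mem_cube: "x \<in> cube a h \<longleftrightarrow> (\<forall>i. a $ i \<le> x $ i \<and> x $ i \<le> a $ i + h)"
  by (simp add: cube_def mem_box_cart)

lemma inj_cube: "0 < h \<Longrightarrow> inj (\<lambda>a. cube a h)"
  by (rule injI) (auto simp: cube_def eq_cbox box_ne_empty interval_eq_empty_cart)

lemma finite_bounded_integer_vectors:
  "finite {z :: real^'n. \<forall>j. z $ j \<in> \<int> \<and> \<bar>z $ j\<bar> \<le> N}"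
proof (rule finite_subset)
  show "{z :: real^'n. \<forall>j. z $ j \<in> \<int> \<and> \<bar>z $ j\<bar> \<le> N}
      \<subseteq> (\<lambda>f. \<chi> j. of_int (f j)) ` (UNIV \<rightarrow>\<^sub>E {- \<lceil>N\<rceil>..\<lceil>N\<rceil>})"
  proof
    fix z :: "real^'n" assume z: "z \<in> {z. \<forall>j. z $ j \<in> \<int> \<and> \<bar>z $ j\<bar> \<le> N}"
    then have "z = (\<chi> j. of_int \<lfloor>z $ j\<rfloor>)" by (simp add: vec_eq_iff)
    moreover have "(\<lambda>j. \<lfloor>z $ j\<rfloor>) \<in> UNIV \<rightarrow>\<^sub>E {- \<lceil>N\<rceil>..\<lceil>N\<rceil>}"
    proof -
      have "- \<lceil>N\<rceil> \<le> \<lfloor>z $ j\<rfloor> \<and> \<lfloor>z $ j\<rfloor> \<le> \<lceil>N\<rceil>" for j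
        using z by (auto simp: abs_le_iff le_floor_iff floor_le_iff) (smt (verit) ceiling_correct)+
      then show ?thesis by auto
    qed
    ultimately show "z \<in> (\<lambda>f. \<chi> j. of_int (f j)) ` (UNIV \<rightarrow>\<^sub>E {- \<lceil>N\<rceil>..\<lceil>N\<rceil>})"
      by (rule image_eqI)
  qed
qed (auto intro!: finite_PiE)

lemma cartesian_grid_cell:
  assumes "cartesian_grid h \<M>" "K \<in> \<M>"
  obtains a where "K = cube a h"
  using assms by (auto simp: cartesian_grid_def)

lemma finite_cells_meeting_bounded:
  fixes B :: "(real^'n) set"
  assumes grid: "cartesian_grid h \<M>" and "bounded B"
  shows "finite {K \<in> \<M>. K \<inter> B \<noteq> {}}"
proof -
  from grid obtain b where h: "0 < h" and b: "\<M> \<subseteq> {cube (b + h *\<^sub>R z) h | z. \<forall>i. z $ i \<in> \<int>}"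
    by (auto simp: cartesian_grid_def)
  obtain R where R: "\<And>x. x \<in> B \<Longrightarrow> norm x \<le> R" using \<open>bounded B\<close> by (auto simp: bounded_iff)
  define N where "N = (R + norm b + h) / h"
  have "{K \<in> \<M>. K \<inter> B \<noteq> {}} \<subseteq> (\<lambda>z. cube (b + h *\<^sub>R z) h) ` {z. \<forall>j. z $ j \<in> \<int> \<and> \<bar>z $ j\<bar> \<le> N}"
  proof
    fix K assume "K \<in> {K \<in> \<M>. K \<inter> B \<noteq> {}}"
    then obtain x where "K \<in> \<M>" and x: "x \<in> K" "x \<in> B" by blast
    then obtain z where z: "K = cube (b + h *\<^sub>R z) h" "\<forall>i. z $ i \<in> \<int>" using b by blast
    have "\<bar>z $ j\<bar> \<le> N" for j
    proof -
      have "\<bar>x $ j\<bar> \<le> R" "\<bar>b $ j\<bar> \<le> norm b"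
        using R[OF x(2)] component_le_norm_cart[of x j] component_le_norm_cart[of b j] by auto
      moreover have "b $ j + h * z $ j \<le> x $ j" "x $ j \<le> b $ j + h * z $ j + h"
        using x(1) by (auto simp: z mem_cube)
      ultimately have "\<bar>h * z $ j\<bar> \<le> R + norm b + h" using h by linarith
      then have "h * \<bar>z $ j\<bar> \<le> R + norm b + h" using h by (simp add: abs_mult)
      then show ?thesis using h by (simp add: N_def pos_le_divide_eq mult.commute)
    qed
    then show "K \<in> (\<lambda>z. cube (b + h *\<^sub>R z) h) ` {z. \<forall>j. z $ j \<in> \<int> \<and> \<bar>z $ j\<bar> \<le> N}"
      unfolding z(1) using z(2) by (intro imageI) simp
  qed
  then show ?thesis by (rule finite_surj[OF finite_bounded_integer_vectors])
qed

lemma finite_active_cells: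
  assumes "cartesian_grid h \<M>" "bounded \<Omega>"
  shows "finite (active_cells \<Omega> \<M>)"
  unfolding active_cells_def by (rule finite_cells_meeting_bounded) fact+

lemma closed_active_domain:
  assumes grid: "cartesian_grid h \<M>" and "bounded \<Omega>"
  shows "closed (active_domain \<Omega> \<M>)"
proof -
  have "closed K" if "K \<in> active_cells \<Omega> \<M>" for K
    using that cartesian_grid_cell[OF grid] closed_cube by (metis (no_types, lifting) active_cells_def mem_Collect_eq)
  then show ?thesis
    unfolding active_domain_def using finite_active_cells[OF assms] by (auto intro: closed_Union)
qed

lemma finite_ghost_faces:
  fixes \<Omega> :: "(real^'n) set"
  assumes "cartesian_grid h \<M>" "bounded \<Omega>"
  shows "finite (ghost_faces \<Omega> \<M> h)"
proof (rule finite_subset)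
  have "0 < h" using assms by (simp add: cartesian_grid_def)
  then show "finite (((\<lambda>a. cube a h) -` active_cells \<Omega> \<M>) \<times> (UNIV :: 'n set))"
    using finite_active_cells[OF assms] by (intro finite_cartesian_product finite_vimageI inj_cube) auto
  show "ghost_faces \<Omega> \<M> h \<subseteq> ((\<lambda>a. cube a h) -` active_cells \<Omega> \<M>) \<times> (UNIV :: 'n set)"
    by (auto simp: ghost_faces_def)
qed

text \<open>
  Only finitely many cells meet a unit ball, so those that miss \<open>x\<close> keep a positive distance from it.
\<close>

lemma grid_locally_at_point:
  assumes grid: "cartesian_grid h \<M>"
  obtains U where "open U" "x \<in> U" "\<And>K. K \<in> \<M> \<Longrightarrow> K \<inter> U \<noteq> {} \<Longrightarrow> x \<in> K"
proof -
  let ?A = "{K \<in> \<M>. K \<inter> ball x 1 \<noteq> {}}"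
  let ?U = "ball x 1 - \<Union>{K \<in> ?A. x \<notin> K}"
  have "finite ?A" by (rule finite_cells_meeting_bounded[OF grid]) simp
  moreover have "closed K" if "K \<in> \<M>" for K
    using that cartesian_grid_cell[OF grid] closed_cube by metis
  ultimately have "closed (\<Union>{K \<in> ?A. x \<notin> K})"
    by (intro closed_Union) (auto elim: rev_finite_subset)
  then have "open ?U"
    by (intro open_Diff) auto
  moreover have "x \<in> ?U" by auto
  moreover have "x \<in> K" if "K \<in> \<M>" "K \<inter> ?U \<noteq> {}" for K using that by blast
  ultimately show thesis using that by blast
qed

text \<open>
  If the cell missed \<open>\<Omega>\<close>, then its interior would miss the closure of \<open>\<Omega>\<close>, so the cell without \<open>\<Gamma>\<close>
  would lie between an open box and the closure of that box. It would be connected, whereas a resolved cut leaves exactly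
  two components.
\<close>

lemma resolved_cut_cell_active:
  fixes \<Omega> :: "(real^'n) set"
  assumes "open \<Omega>" "0 < h" and res: "resolved_cut (frontier \<Omega>) a h"
  shows "cube a h \<inter> \<Omega> \<noteq> {}"
proof
  assume disj: "cube a h \<inter> \<Omega> = {}"
  let ?I = "box a (\<chi> i. a $ i + h)"
  have ne: "?I \<noteq> {}" using \<open>0 < h\<close> by (auto simp: interval_eq_empty_cart)
  have "?I \<inter> \<Omega> = {}" using disj box_subset_cbox by (fastforce simp: cube_def)
  then have "?I \<inter> closure \<Omega> = {}" by (simp add: open_Int_closure_eq_empty[OF open_box])
  then have "?I \<subseteq> cube a h - frontier \<Omega>"
    using box_subset_cbox by (fastforce simp: cube_def frontier_def)
  moreover have "cube a h - frontier \<Omega> \<subseteq> closure ?I"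
    using closure_box[OF ne] by (auto simp: cube_def)
  ultimately have "connected (cube a h - frontier \<Omega>)"
    using connected_intermediate_closure[of ?I] convex_connected[OF convex_box(2)] by blast
  then have "components (cube a h - frontier \<Omega>) \<subseteq> {cube a h - frontier \<Omega>}"
    by (metis (no_types, opaque_lifting) components_empty components_eq_sing_iff empty_subsetI order_refl)
  then have "card (components (cube a h - frontier \<Omega>)) \<le> 1"
    using card_mono[of "{cube a h - frontier \<Omega>}"] by simp
  then show False using res by (simp add: resolved_cut_def)
qed

text \<open>
  Whether a linear map is a derivative within \<open>S\<close> depends only on the germ of \<open>S\<close> and on values in \<open>S\<close>. Both
  gradients are therefore the same choice, also where no derivative exists or where it is not unique.
\<close>

lemma gradient_cong:
  assumes "open U" "x \<in> U" "x \<in> S" and ST: "S \<inter> U = T \<inter> U" and eq: "\<And>y. y \<in> S \<Longrightarrow> f y = g y"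
  shows "gradient S f x = gradient T g x"
proof -
  have at: "at x within T = at x within S"
    by (rule at_within_nhd[of x U]) (use assms in auto)
  have "(f has_derivative f') (at x within S) \<longleftrightarrow> (g has_derivative f') (at x within S)" for f'
    using has_derivative_transform[of x S g f f'] has_derivative_transform[of x S f g f'] assms(3) eq by metis
  then show ?thesis
    unfolding gradient_def frechet_derivative_def at by simp
qed

lemma dyadic_refinementE:
  assumes "K \<in> dyadic_refinement h \<M>"
  obtains a e where "cube a h \<in> \<M>" "\<And>i. e $ i \<in> {0, 1}" "K = cube (a + (h / 2) *\<^sub>R e) (h / 2)"
  using assms by (auto simp: dyadic_refinement_def)

lemma child_subset:
  fixes a e :: "real^'n"
  assumes "0 < h" and e: "\<And>i. e $ i \<in> {0, 1}"
  shows "cube (a + (h / 2) *\<^sub>R e) (h / 2) \<subseteq> cube a h"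
proof
  fix x assume x: "x \<in> cube (a + (h / 2) *\<^sub>R e) (h / 2)"
  have "a $ i \<le> x $ i \<and> x $ i \<le> a $ i + h" for i
    using spec[OF x[unfolded mem_cube], of i] e[of i] \<open>0 < h\<close> by auto
  then show "x \<in> cube a h" by (simp add: mem_cube)
qed

lemma Union_dyadic_refinement:
  assumes grid: "cartesian_grid h (\<M> :: (real^'n) set set)"
  shows "\<Union>(dyadic_refinement h \<M>) = \<Union>\<M>"
proof
  have h: "0 < h" using grid by (simp add: cartesian_grid_def)
  show "\<Union>(dyadic_refinement h \<M>) \<subseteq> \<Union>\<M>"
    by (rule Union_least, erule dyadic_refinementE) (use child_subset[OF h] in blast)
  show "\<Union>\<M> \<subseteq> \<Union>(dyadic_refinement h \<M>)"
  proof
    fix x assume "x \<in> \<Union>\<M>"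
    then obtain a where a: "cube a h \<in> \<M>" "x \<in> cube a h" using cartesian_grid_cell[OF grid] by blast
    define e :: "real^'n" where "e = (\<chi> i. if x $ i \<le> a $ i + h / 2 then 0 else 1)"
    have "cube (a + (h / 2) *\<^sub>R e) (h / 2) \<in> dyadic_refinement h \<M>"
      unfolding dyadic_refinement_def using a(1)
      by (intro CollectI exI[of _ a] exI[of _ e]) (simp add: e_def)
    moreover have "x \<in> cube (a + (h / 2) *\<^sub>R e) (h / 2)"
      using a(2) by (auto simp: mem_cube e_def add.commute)
    ultimately show "x \<in> \<Union>(dyadic_refinement h \<M>)" by blast
  qed
qed

section \<open>Prolongation to the refined mesh\<close>

text \<open>One refinement step: \<open>h\<close> and \<open>\<M>\<close> belong to the coarse level.\<close>

locale refined_cut_mesh =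
  fixes \<Omega> :: "(real^'n) set" and h :: real and \<M> :: "(real^'n) set set"
  assumes dim: "2 \<le> CARD('n)"
    and open_domain: "open \<Omega>" and bounded_domain: "bounded \<Omega>"
    and coarse_grid: "cartesian_grid h \<M>"
    and fine_grid: "cartesian_grid (h / 2) (dyadic_refinement h \<M>)"
    and cover: "\<Omega> \<subseteq> \<Union>\<M>"
    and resolved: "\<And>a. cube a (h / 2) \<in> dyadic_refinement h \<M> \<Longrightarrow> is_cut \<Omega> (cube a (h / 2)) \<Longrightarrow>
      resolved_cut (frontier \<Omega>) a (h / 2)"
begin

abbreviation refined :: "(real^'n) set set" where "refined \<equiv> dyadic_refinement h \<M>"

abbreviation prolong :: "(real^'n \<Rightarrow> real) \<Rightarrow> real^'n \<Rightarrow> real" where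
  "prolong \<equiv> prolongation \<Omega> refined"

lemma h_pos: "0 < h"
  using coarse_grid by (simp add: cartesian_grid_def)

lemma fine_cover: "\<Omega> \<subseteq> \<Union>refined"
  using cover Union_dyadic_refinement[OF coarse_grid] by simp

lemma domain_subset_active: "\<Omega> \<subseteq> active_domain \<Omega> refined" "\<Omega> \<subseteq> active_domain \<Omega> \<M>"
  using cover fine_cover unfolding active_domain_def active_cells_def by blast+

lemma closure_subset_active: "closure \<Omega> \<subseteq> active_domain \<Omega> refined"
  by (rule closure_minimal[OF domain_subset_active(1) closed_active_domain[OF fine_grid bounded_domain]])

lemma parent_active:
  assumes "cube a h \<in> \<M>" "\<And>i. e $ i \<in> {0, 1}" "cube (a + (h / 2) *\<^sub>R e) (h / 2) \<in> active_cells \<Omega> refined"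
  shows "cube a h \<in> active_cells \<Omega> \<M>"
  using assms child_subset[OF h_pos, of e a] by (auto simp: active_cells_def)

lemma active_cell_parent:
  assumes "K \<in> active_cells \<Omega> refined"
  obtains a e where "cube a h \<in> active_cells \<Omega> \<M>" "\<And>i. e $ i \<in> {0, 1}"
    "K = cube (a + (h / 2) *\<^sub>R e) (h / 2)"
proof -
  have "K \<in> refined" using assms by (simp add: active_cells_def)
  then obtain a e where *: "cube a h \<in> \<M>" "\<And>i. e $ i \<in> {0, 1}" "K = cube (a + (h / 2) *\<^sub>R e) (h / 2)"
    using dyadic_refinementE by metis
  show thesis by (rule that[OF parent_active[OF *(1,2)] *(2,3)]) (use assms *(3) in auto)
qed

lemma active_domain_antimono: "active_domain \<Omega> refined \<subseteq> active_domain \<Omega> \<M>"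
proof
  fix x assume "x \<in> active_domain \<Omega> refined"
  then obtain K where K: "K \<in> active_cells \<Omega> refined" "x \<in> K" by (auto simp: active_domain_def)
  obtain a e where "cube a h \<in> active_cells \<Omega> \<M>" "\<And>i. e $ i \<in> {0, 1}" "K = cube (a + (h / 2) *\<^sub>R e) (h / 2)"
    using active_cell_parent[OF K(1)] by metis
  then show "x \<in> active_domain \<Omega> \<M>"
    using K(2) child_subset[OF h_pos, of e a] by (auto simp: active_domain_def)
qed

lemma cell_touching_boundary_active:
  assumes "K \<in> refined" "x \<in> K" "x \<in> frontier \<Omega>"
  shows "K \<in> active_cells \<Omega> refined"
proof -
  obtain a where a: "K = cube a (h / 2)" using cartesian_grid_cell[OF fine_grid assms(1)] by blast
  have "resolved_cut (frontier \<Omega>) a (h / 2)"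
    using assms a by (intro resolved) (auto simp: is_cut_def)
  then have "cube a (h / 2) \<inter> \<Omega> \<noteq> {}"
    using h_pos by (intro resolved_cut_cell_active open_domain) auto
  then show ?thesis using assms a by (simp add: active_cells_def)
qed

text \<open>
  Near a boundary point all fine cells are active, so the fine active domain is locally everything that the grid
  covers. The coarse active domain lies between these two sets.
\<close>

lemma active_domains_locally_equal:
  assumes "x \<in> closure \<Omega>"
  obtains U where "open U" "x \<in> U" "active_domain \<Omega> refined \<inter> U = active_domain \<Omega> \<M> \<inter> U"
proof (cases "x \<in> \<Omega>")
  case True
  have "active_domain \<Omega> refined \<inter> \<Omega> = active_domain \<Omega> \<M> \<inter> \<Omega>" using domain_subset_active by auto
  then show thesis using that open_domain True by blast
next
  case False
  then have x: "x \<in> frontier \<Omega>" using assms open_domain by (simp add: frontier_def interior_open)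
  obtain U where U: "open U" "x \<in> U" "\<And>K. K \<in> refined \<Longrightarrow> K \<inter> U \<noteq> {} \<Longrightarrow> x \<in> K"
    using grid_locally_at_point[OF fine_grid] by metis
  have "y \<in> active_domain \<Omega> refined" if "y \<in> active_domain \<Omega> \<M>" "y \<in> U" for y
  proof -
    have "y \<in> \<Union>refined"
      using that(1) Union_dyadic_refinement[OF coarse_grid] by (auto simp: active_domain_def active_cells_def)
    then obtain K where K: "K \<in> refined" "y \<in> K" by blast
    then have "K \<in> active_cells \<Omega> refined"
      using U(3)[of K] that(2) x by (intro cell_touching_boundary_active) auto
    then show ?thesis using K(2) by (auto simp: active_domain_def)
  qed
  then have "active_domain \<Omega> refined \<inter> U = active_domain \<Omega> \<M> \<inter> U" using active_domain_antimono by auto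
  then show thesis using that U by blast
qed

lemma prolong_eq: "x \<in> closure \<Omega> \<Longrightarrow> prolong v x = v x"
  using closure_subset_active by (auto simp: prolongation_def)

lemma nabla_prolong:
  assumes "x \<in> closure \<Omega>"
  shows "nabla \<Omega> refined (prolong v) x = nabla \<Omega> \<M> v x"
proof -
  obtain U where U: "open U" "x \<in> U" "active_domain \<Omega> refined \<inter> U = active_domain \<Omega> \<M> \<inter> U"
    using active_domains_locally_equal[OF assms] by metis
  show ?thesis
    unfolding nabla_def
    by (rule gradient_cong[OF U(1,2) _ U(3)])
      (use assms closure_subset_active in \<open>auto simp: prolongation_def\<close>)
qed

lemma H1_seminorm_prolong: "H1_seminorm_sq \<Omega> refined \<Omega> (prolong v) = H1_seminorm_sq \<Omega> \<M> \<Omega> v"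
  unfolding H1_seminorm_sq_def set_lebesgue_integral_def
  by (rule Bochner_Integration.integral_cong)
    (use nabla_prolong[of _ v] closure_subset[of \<Omega>] in \<open>auto simp: indicator_def\<close>)

lemma surface_inner_prolong:
  "surface_inner (frontier \<Omega>) (prolong v) (prolong v) = surface_inner (frontier \<Omega>) v v"
  unfolding surface_inner_def set_lebesgue_integral_def
  by (rule Bochner_Integration.integral_cong)
    (use prolong_eq[of _ v] in \<open>auto simp: indicator_def frontier_def\<close>)

lemma surface_inner_normal_deriv_prolong:
  "surface_inner (frontier \<Omega>) (normal_deriv \<Omega> refined (prolong v)) (normal_deriv \<Omega> refined (prolong v)) =
   surface_inner (frontier \<Omega>) (normal_deriv \<Omega> \<M> v) (normal_deriv \<Omega> \<M> v)"
  unfolding surface_inner_def set_lebesgue_integral_def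
  by (rule Bochner_Integration.integral_cong)
    (use nabla_prolong[of _ v] in \<open>auto simp: indicator_def frontier_def normal_deriv_def\<close>)

lemma cell_poly_child:
  assumes v: "v \<in> fe_space p \<Omega> \<M>" and K: "cube a h \<in> active_cells \<Omega> \<M>"
    and e: "\<And>i. e $ i \<in> {0, 1}" and child: "cube (a + (h / 2) *\<^sub>R e) (h / 2) \<in> active_cells \<Omega> refined"
  shows "cell_poly p (cube (a + (h / 2) *\<^sub>R e) (h / 2)) (prolong v) = cell_poly p (cube a h) v"
    and "cell_poly p (cube a h) v \<in> Qpoly p"
proof -
  obtain q where q: "q \<in> Qpoly p" "\<And>x. x \<in> cube a h \<Longrightarrow> v x = q x"
    using v K by (auto simp: fe_space_def)
  have coarse: "cell_poly p (cube a h) v = q" by (rule cell_poly_eq[OF h_pos q])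
  have "prolong v x = q x" if "x \<in> cube (a + (h / 2) *\<^sub>R e) (h / 2)" for x
    using that q(2)[of x] child_subset[OF h_pos, of e a] e child
    by (auto simp: prolongation_def active_domain_def)
  then show "cell_poly p (cube (a + (h / 2) *\<^sub>R e) (h / 2)) (prolong v) = cell_poly p (cube a h) v"
    unfolding coarse using h_pos q(1) by (intro cell_poly_eq) auto
  show "cell_poly p (cube a h) v \<in> Qpoly p" using coarse q(1) by simp
qed

lemma prolong_in_fe_space:
  assumes v: "v \<in> fe_space p \<Omega> \<M>"
  shows "prolong v \<in> fe_space p \<Omega> refined"
proof -
  have "continuous_on (active_domain \<Omega> refined) (prolong v)"
  proof (rule continuous_on_eq)
    show "continuous_on (active_domain \<Omega> refined) v"
      using v active_domain_antimono by (auto simp: fe_space_def intro: continuous_on_subset)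
  qed (simp add: prolongation_def)
  moreover have "\<exists>q\<in>Qpoly p. \<forall>x\<in>K. prolong v x = q x" if K: "K \<in> active_cells \<Omega> refined" for K
  proof -
    obtain a e where ae: "cube a h \<in> active_cells \<Omega> \<M>" "\<And>i. e $ i \<in> {0, 1}"
      "K = cube (a + (h / 2) *\<^sub>R e) (h / 2)"
      using active_cell_parent[OF K] by metis
    obtain q where "q \<in> Qpoly p" "\<forall>x\<in>cube a h. v x = q x"
      using v ae(1) by (auto simp: fe_space_def)
    then show ?thesis
      using child_subset[OF h_pos, of e a] ae(2,3) K
      by (intro bexI[of _ q]) (auto simp: prolongation_def active_domain_def)
  qed
  ultimately show ?thesis by (auto simp: fe_space_def prolongation_def)
qed

text \<open>
  All coarse corners lie in one translate of the lattice of multiples of \<open>h\<close>. Measured in units of \<open>h / 2\<close>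
  the corners of the parents hence differ by even integers, while the positions of the children inside their parents are 0 or
  1 in each coordinate. Adjacency in direction \<open>i\<close> then leaves two possibilities: the parents coincide, or
  the first child is an upper one and its parent is followed by the other parent.
\<close>

lemma adjacent_children:
  assumes K: "cube a h \<in> \<M>" "cube a' h \<in> \<M>" and e: "\<And>j. e $ j \<in> {0, 1}" "\<And>j. e' $ j \<in> {0, 1}"
    and adj: "a' + (h / 2) *\<^sub>R e' = a + (h / 2) *\<^sub>R e + axis i (h / 2)"
  shows "a' = a \<or> a' = a + axis i h \<and> e $ i = 1"
proof -
  obtain b where b: "\<M> \<subseteq> {cube (b + h *\<^sub>R z) h | z. \<forall>i. z $ i \<in> \<int>}"
    using coarse_grid by (auto simp: cartesian_grid_def)
  obtain z z' where z: "a = b + h *\<^sub>R z" "\<And>j. z $ j \<in> \<int>" and z': "a' = b + h *\<^sub>R z'" "\<And>j. z' $ j \<in> \<int>"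
    using b K injD[OF inj_cube[OF h_pos]] by (smt (verit) mem_Collect_eq subsetD)
  have comp: "2 * (z' $ j - z $ j) = e $ j - e' $ j + (if j = i then 1 else 0)" for j
  proof -
    have "h * (2 * z' $ j + e' $ j) = h * (2 * z $ j + e $ j + (if j = i then 1 else 0))"
      using arg_cong[OF adj, of "\<lambda>x. x $ j"] by (auto simp: z(1) z'(1) axis_def field_simps)
    then have "2 * z' $ j + e' $ j = 2 * z $ j + e $ j + (if j = i then 1 else 0)"
      using h_pos by (metis less_irrefl mult_left_cancel)
    then show ?thesis by simp
  qed
  have diff: "z' $ j - z $ j = (if j = i \<and> e $ i = 1 \<and> e' $ i = 0 then 1 else 0)" for j
  proof -
    obtain m :: int where m: "z' $ j - z $ j = of_int m" using z(2) z'(2) by (meson Ints_cases Ints_diff)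
    have "2 * m = (if e $ j = 1 then 1 else 0) - (if e' $ j = 1 then 1 else 0) + (if j = i then 1 else 0)"
      using comp[of j] e(1)[of j] e(2)[of j] unfolding m by (auto split: if_splits)
    then have "m = (if j = i \<and> e $ i = 1 \<and> e' $ i = 0 then 1 else 0)"
      using e(1)[of j] e(2)[of j] by (auto split: if_splits)
    then show ?thesis using m by simp
  qed
  have "z' $ j = z $ j + (if j = i \<and> e $ i = 1 \<and> e' $ i = 0 then 1 else 0)" for j
    using diff[of j] by linarith
  then show ?thesis
    by (auto simp: z(1) z'(1) vec_eq_iff axis_def algebra_simps)
qed

text \<open>
  The jump across a fine face only involves the polynomials of the two parents. If the parents coincide it
  vanishes. If they differ, the fine face lies in their common face, and a parent of a cut cell is cut.
\<close>

lemma fine_ghost_face_cases: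
  assumes v: "v \<in> fe_space p \<Omega> \<M>" and F: "(c, i) \<in> ghost_faces \<Omega> refined (h / 2)"
  obtains (interior) "\<And>k. jump_normal_deriv p (h / 2) (c, i) k (prolong v) = (\<lambda>x. 0)"
  | (inherited) a e where "(a, i) \<in> ghost_faces \<Omega> \<M> h" "\<And>j. e $ j \<in> {0, 1}" "c = a + (h / 2) *\<^sub>R e"
      "face_set (h / 2) (c, i) \<subseteq> face_set h (a, i)"
      "\<And>k. jump_normal_deriv p (h / 2) (c, i) k (prolong v) = jump_normal_deriv p h (a, i) k v"
      "\<And>k. continuous_on UNIV (jump_normal_deriv p h (a, i) k v)"
proof -
  from F have act: "cube c (h / 2) \<in> active_cells \<Omega> refined"
      "cube (c + axis i (h / 2)) (h / 2) \<in> active_cells \<Omega> refined"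
    and cut: "is_cut \<Omega> (cube c (h / 2)) \<or> is_cut \<Omega> (cube (c + axis i (h / 2)) (h / 2))"
    by (auto simp: ghost_faces_def)
  have inj: "x = y" if "cube x (h / 2) = cube y (h / 2)" for x y :: "real^'n"
    using injD[OF inj_cube[of "h / 2"] that] h_pos by simp
  obtain a e where a: "cube a h \<in> active_cells \<Omega> \<M>" and e: "\<And>j. e $ j \<in> {0, 1}"
    and c: "c = a + (h / 2) *\<^sub>R e"
    using active_cell_parent[OF act(1)] inj by metis
  obtain a' e' where a': "cube a' h \<in> active_cells \<Omega> \<M>" and e': "\<And>j. e' $ j \<in> {0, 1}"
    and c': "c + axis i (h / 2) = a' + (h / 2) *\<^sub>R e'"
    using active_cell_parent[OF act(2)] inj by metis
  have poly: "cell_poly p (cube c (h / 2)) (prolong v) = cell_poly p (cube a h) v"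
    "cell_poly p (cube (c + axis i (h / 2)) (h / 2)) (prolong v) = cell_poly p (cube a' h) v"
    "cell_poly p (cube a h) v \<in> Qpoly p" "cell_poly p (cube a' h) v \<in> Qpoly p"
    using cell_poly_child[OF v a e] cell_poly_child[OF v a' e'] act c c' by simp_all
  have jump: "jump_normal_deriv p (h / 2) (c, i) k (prolong v)
      = (\<lambda>x. cell_normal_deriv p k i (cube a h) v x - cell_normal_deriv p k i (cube a' h) v x)" for k
    by (rule ext) (simp add: jump_normal_deriv_def cell_normal_deriv_def poly)
  have "a' = a \<or> a' = a + axis i h \<and> e $ i = 1"
    using a a' c c' by (intro adjacent_children[OF _ _ e e']) (auto simp: active_cells_def)
  then show thesis
  proof
    assume "a' = a"
    then show thesis using interior jump by simp
  next
    assume *: "a' = a + axis i h \<and> e $ i = 1"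
    have sub: "cube c (h / 2) \<subseteq> cube a h" "cube (c + axis i (h / 2)) (h / 2) \<subseteq> cube a' h"
      using child_subset[OF h_pos] e e' c c' by auto
    show thesis
    proof (rule inherited[OF _ e c])
      show "(a, i) \<in> ghost_faces \<Omega> \<M> h"
        using a a' * cut sub by (auto simp: ghost_faces_def is_cut_def)
      show "face_set (h / 2) (c, i) \<subseteq> face_set h (a, i)"
        using sub * by (auto simp: face_set_def)
      \<comment> \<open>The fine and the coarse face have the same direction \<open>i\<close>, so no sign is lost.\<close>
      show eq: "jump_normal_deriv p (h / 2) (c, i) k (prolong v) = jump_normal_deriv p h (a, i) k v" for k
        unfolding jump using * by (simp add: jump_normal_deriv_def)
      show "continuous_on UNIV (jump_normal_deriv p h (a, i) k v)" for k
        unfolding eq[symmetric] jump by (intro continuous_intros continuous_cell_normal_deriv poly)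
    qed
  qed
qed

text \<open>
  Every fine ghost face with a nonzero contribution is determined by a coarse ghost face and the position of a child
  in its parent. So the fine sum is dominated by one copy of the coarse sum for each child position.
\<close>

lemma g_form_prolong_le:
  assumes v: "v \<in> fe_space p \<Omega> \<M>" and "0 \<le> \<gamma>"
  shows "g_form p \<gamma> \<Omega> refined (h / 2) (prolong v) (prolong v)
    \<le> card {e :: real^'n. \<forall>i. e $ i \<in> {0, 1}} * g_form p \<gamma> \<Omega> \<M> h v v"
proof -
  let ?E = "{e :: real^'n. \<forall>i. e $ i \<in> {0, 1}}"
  let ?G = "ghost_faces \<Omega> \<M> h" and ?g = "ghost_faces \<Omega> refined (h / 2)"
  define T where "T F = (\<Sum>k=1..p. h ^ (2 * k - 1) / (fact k)\<^sup>2 *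
    surface_inner (face_set h F) (jump_normal_deriv p h F k v) (jump_normal_deriv p h F k v))" for F
  define t where "t F = (\<Sum>k=1..p. (h / 2) ^ (2 * k - 1) / (fact k)\<^sup>2 *
    surface_inner (face_set (h / 2) F) (jump_normal_deriv p (h / 2) F k (prolong v))
      (jump_normal_deriv p (h / 2) F k (prolong v)))" for F
  have T0: "0 \<le> T F" for F
    unfolding T_def using h_pos by (intro sum_nonneg mult_nonneg_nonneg surface_inner_self_nonneg) auto
  have finE: "finite ?E"
  proof (rule finite_subset[OF _ finite_bounded_integer_vectors[of 1]], intro subsetI CollectI allI)
    fix e :: "real^'n" and j assume "e \<in> ?E"
    then have "e $ j = 0 \<or> e $ j = 1" by simp
    then show "e $ j \<in> \<int> \<and> \<bar>e $ j\<bar> \<le> 1" by auto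
  qed
  have child: "\<exists>y\<in>?G \<times> ?E. (fst (fst y) + (h / 2) *\<^sub>R snd y, snd (fst y)) = F \<and> t F \<le> T (fst y)"
    if F: "F \<in> ?g" "t F \<noteq> 0" for F
  proof -
    obtain c i where ci: "F = (c, i)" by fastforce
    show ?thesis
      using v F(1)[unfolded ci]
    proof (cases rule: fine_ghost_face_cases)
      case interior
      then have "t F = 0" by (simp add: t_def ci surface_inner_def set_lebesgue_integral_def)
      then show ?thesis using F(2) by simp
    next
      case (inherited a e)
      have "t F \<le> T (a, i)"
        unfolding t_def T_def ci inherited(5)
        using h_pos by (intro sum_mono mult_mono divide_right_mono power_mono surface_inner_face_mono
          dim inherited(4,6) surface_inner_self_nonneg) auto
      then show ?thesis using inherited(1-3) by (intro bexI[of _ "((a, i), e)"]) (auto simp: ci)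
    qed
  qed
  have "(\<Sum>F\<in>?g. t F) = (\<Sum>F\<in>{F \<in> ?g. t F \<noteq> 0}. t F)"
    using finite_ghost_faces[OF fine_grid bounded_domain] by (intro sum.mono_neutral_right) auto
  also have "\<dots> \<le> (\<Sum>y\<in>?G \<times> ?E. T (fst y))"
    by (rule sum_le_included[where i = "\<lambda>y. (fst (fst y) + (h / 2) *\<^sub>R snd y, snd (fst y))"])
      (use finite_ghost_faces[OF fine_grid bounded_domain] finite_ghost_faces[OF coarse_grid bounded_domain]
        finE T0 child in auto)
  also have "\<dots> = card ?E * (\<Sum>F\<in>?G. T F)"
    by (simp add: sum.cartesian_product' sum_distrib_left)
  finally have "\<gamma> * (\<Sum>F\<in>?g. t F) \<le> \<gamma> * (card ?E * (\<Sum>F\<in>?G. T F))"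
    using \<open>0 \<le> \<gamma>\<close> by (rule mult_left_mono)
  then show ?thesis by (simp add: g_form_def t_def T_def mult.left_commute)
qed

end

lemma g_form_self_nonneg:
  assumes "0 \<le> \<gamma>" "0 \<le> h"
  shows "0 \<le> g_form p \<gamma> \<Omega> \<M> h v v"
  unfolding g_form_def using assms
  by (intro mult_nonneg_nonneg sum_nonneg surface_inner_self_nonneg divide_nonneg_nonneg) auto

lemma N_norm_sq:
  assumes "0 \<le> \<gamma>" "0 \<le> h"
  shows "(N_norm p \<gamma> \<Omega> \<M> h v)\<^sup>2 = H1_seminorm_sq \<Omega> \<M> \<Omega> v
     + h * surface_inner (frontier \<Omega>) (normal_deriv \<Omega> \<M> v) (normal_deriv \<Omega> \<M> v)
     + 1 / h * surface_inner (frontier \<Omega>) v v + g_form p \<gamma> \<Omega> \<M> h v v"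
proof -
  have "0 \<le> H1_seminorm_sq \<Omega> \<M> \<Omega> v"
    unfolding H1_seminorm_sq_def set_lebesgue_integral_def by (rule integral_nonneg_AE) (auto simp: indicator_def)
  then show ?thesis
    unfolding N_norm_def using assms
    by (intro real_sqrt_pow2 add_nonneg_nonneg mult_nonneg_nonneg surface_inner_self_nonneg g_form_self_nonneg) auto
qed

text \<open>
  Halving the mesh size halves the weight \<open>h\<close> of the flux term and doubles the weight \<open>1 / h\<close> of the trace
  term; this is where the summand 2 comes from. The cardinality is the number of children of a cell.
\<close>

lemma (in refined_cut_mesh) N_norm_prolong_le:
  assumes v: "v \<in> fe_space p \<Omega> \<M>" and "0 \<le> \<gamma>"
  shows "(N_norm p \<gamma> \<Omega> refined (h / 2) (prolong v))\<^sup>2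
    \<le> (2 + card {e :: real^'n. \<forall>i. e $ i \<in> {0, 1}}) * (N_norm p \<gamma> \<Omega> \<M> h v)\<^sup>2"
proof -
  let ?c = "card {e :: real^'n. \<forall>i. e $ i \<in> {0, 1}}"
  define A where "A = H1_seminorm_sq \<Omega> \<M> \<Omega> v"
  define B where "B = h * surface_inner (frontier \<Omega>) (normal_deriv \<Omega> \<M> v) (normal_deriv \<Omega> \<M> v)"
  define D where "D = 1 / h * surface_inner (frontier \<Omega>) v v"
  define G where "G = g_form p \<gamma> \<Omega> \<M> h v v"
  have nn: "0 \<le> A" "0 \<le> B" "0 \<le> D" "0 \<le> G"
    using h_pos \<open>0 \<le> \<gamma>\<close> unfolding A_def B_def D_def G_def H1_seminorm_sq_def set_lebesgue_integral_def
    by (auto intro!: integral_nonneg_AE mult_nonneg_nonneg divide_nonneg_pos surface_inner_self_nonneg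
        g_form_self_nonneg)
  have "(N_norm p \<gamma> \<Omega> refined (h / 2) (prolong v))\<^sup>2
      = A + B / 2 + 2 * D + g_form p \<gamma> \<Omega> refined (h / 2) (prolong v) (prolong v)"
    using h_pos \<open>0 \<le> \<gamma>\<close>
    by (simp add: N_norm_sq H1_seminorm_prolong surface_inner_normal_deriv_prolong surface_inner_prolong
        A_def B_def D_def)
  also have "\<dots> \<le> A + B / 2 + 2 * D + ?c * G"
    using g_form_prolong_le[OF v \<open>0 \<le> \<gamma>\<close>] by (simp add: G_def)
  also have "\<dots> \<le> (2 + ?c) * (A + B + D + G)"
    using nn by (simp add: algebra_simps)
  also have "A + B + D + G = (N_norm p \<gamma> \<Omega> \<M> h v)\<^sup>2"
    using h_pos \<open>0 \<le> \<gamma>\<close> by (simp add: N_norm_sq A_def B_def D_def G_def)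
  finally show ?thesis .
qed

theorem lemma1:
  fixes p :: nat and \<gamma> \<gamma>D cA CA C :: real
  assumes "CARD('n::finite) \<in> {2, 3}" and "1 \<le> p" and "0 < \<gamma>" and "\<gamma> \<le> 1"
    and "0 < cA" and "0 < CA" and "0 < C"
  shows "\<exists>Cpr. \<forall>(\<Omega> :: (real^'n) set) L h \<M> \<delta>0.
           open \<Omega> \<and> connected \<Omega> \<and> bounded \<Omega> \<and> \<Omega> \<noteq> {} \<and> grid_hierarchy \<Omega> L h \<M> \<and>
           geometric_assumption \<Omega> \<delta>0 L h \<M> \<and>
           cutfem_stability p \<gamma> \<gamma>D cA CA C \<Omega> L h \<M> \<longrightarrow>
           (\<forall>l. 1 \<le> l \<and> l \<le> L \<longrightarrow>
             (\<forall>v\<in>fe_space p \<Omega> (\<M> (l - 1)).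
               energy_norm p \<gamma> \<gamma>D \<Omega> (\<M> l) (h l) (prolongation \<Omega> (\<M> l) v)
                 \<le> Cpr * energy_norm p \<gamma> \<gamma>D \<Omega> (\<M> (l - 1)) (h (l - 1)) v))"
proof (intro exI allI impI ballI)
  fix \<Omega> :: "(real^'n) set" and L h \<M> \<delta>0 l v
  let ?c = "2 + real (card {e :: real^'n. \<forall>i. e $ i \<in> {0, 1}})"
  assume A: "open \<Omega> \<and> connected \<Omega> \<and> bounded \<Omega> \<and> \<Omega> \<noteq> {} \<and> grid_hierarchy \<Omega> L h \<M> \<and>
      geometric_assumption \<Omega> \<delta>0 L h \<M> \<and> cutfem_stability p \<gamma> \<gamma>D cA CA C \<Omega> L h \<M>"
    and l: "1 \<le> l \<and> l \<le> L" and v: "v \<in> fe_space p \<Omega> (\<M> (l - 1))"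
  let ?H = "h (l - 1)" and ?M = "\<M> (l - 1)"
  have fine: "h l = ?H / 2" "\<M> l = dyadic_refinement ?H ?M"
    and grid: "cartesian_grid ?H ?M" "cartesian_grid (h l) (\<M> l)" "\<Omega> \<subseteq> \<Union>?M"
    using A l unfolding grid_hierarchy_def by (blast, blast, meson diff_le_self le_trans, blast, meson diff_le_self le_trans)
  have res: "resolved_cut (frontier \<Omega>) a (h l)" if "cube a (h l) \<in> \<M> l" "is_cut \<Omega> (cube a (h l))" for a
    using A l that unfolding geometric_assumption_def by blast
  interpret refined_cut_mesh \<Omega> ?H ?M
    using assms(1) A grid res fine by unfold_locales auto
  have stab: "cA * (N_norm p \<gamma> \<Omega> (\<M> m) (h m) u)\<^sup>2 \<le> A_form p \<gamma> \<gamma>D \<Omega> (\<M> m) (h m) u u"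
    "A_form p \<gamma> \<gamma>D \<Omega> (\<M> m) (h m) u u \<le> CA * (N_norm p \<gamma> \<Omega> (\<M> m) (h m) u)\<^sup>2"
    if "m \<le> L" "u \<in> fe_space p \<Omega> (\<M> m)" for m u
    using A that unfolding cutfem_stability_def power2_eq_square by (metis, metis mult.assoc)
  let ?w = "prolongation \<Omega> (\<M> l) v"
  have w: "?w \<in> fe_space p \<Omega> (\<M> l)" unfolding fine by (rule prolong_in_fe_space[OF v])
  have "A_form p \<gamma> \<gamma>D \<Omega> (\<M> l) (h l) ?w ?w \<le> CA * (N_norm p \<gamma> \<Omega> (\<M> l) (h l) ?w)\<^sup>2"
    using l w by (intro stab) auto
  also have "\<dots> \<le> CA * (?c * (N_norm p \<gamma> \<Omega> ?M ?H v)\<^sup>2)"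
    unfolding fine using \<open>0 < CA\<close> \<open>0 < \<gamma>\<close> N_norm_prolong_le[OF v, of \<gamma>] by (intro mult_left_mono) auto
  also have "\<dots> = (CA * ?c / cA) * (cA * (N_norm p \<gamma> \<Omega> ?M ?H v)\<^sup>2)"
    using \<open>0 < cA\<close> by simp
  also have "\<dots> \<le> (CA * ?c / cA) * A_form p \<gamma> \<gamma>D \<Omega> ?M ?H v v"
    using l v \<open>0 < CA\<close> \<open>0 < cA\<close> by (intro mult_left_mono stab) auto
  finally show "energy_norm p \<gamma> \<gamma>D \<Omega> (\<M> l) (h l) ?w
      \<le> sqrt (CA * ?c / cA) * energy_norm p \<gamma> \<gamma>D \<Omega> ?M ?H v"
    unfolding energy_norm_def real_sqrt_mult[symmetric] by (rule real_sqrt_le_mono)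
qed

end
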